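(* If $P$ is a $d$-polytope with two nonsimple vertices, then the graph of $P$ determines the entire combinatorial structure (face lattice) of $P$.
   Context: A vertex of a $d$-polytope is nonsimple if it is incident to more than $d$ edges. The graph of $P$ determines its face lattice means: every $d$-polytope whose graph is isomorphic to that of $P$ is combinatorially isomorphic to $P$. *)

theory Defs
  imports "HOL-Analysis.Analysis"
begin

definition d_polytope :: "nat \<Rightarrow> 'a::euclidean_space set \<Rightarrow> bool" where
  "d_polytope d P \<longleftrightarrow> polytope P \<and> aff_dim P = int d"

definition vertices :: "'a::euclidean_space set \<Rightarrow> 'a set" where
  "vertices P = {v. v extreme_point_of P}"

definition nonsimple_vertices :: "nat \<Rightarrow> 'a::euclidean_space set \<Rightarrow> 'a set" where
  "nonsimple_vertices d P = {v \<in> vertices P. card {e. e edge_of P \<and> v \<in> e} > d}"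

text \<open>A simple graph is a pair of a vertex set and a set of two-element vertex sets.
  In the graph of a polytope each edge is recorded by its two endpoints; the case
  \<open>u = v\<close> does not occur, because \<^const>\<open>edge_of\<close> requires affine dimension 1.\<close>

definition polytope_graph :: "'a::euclidean_space set \<Rightarrow> 'a set \<times> 'a set set" where
  "polytope_graph P =
     (vertices P,
      {{u, v} | u v. u \<in> vertices P \<and> v \<in> vertices P \<and> closed_segment u v edge_of P})"

definition graph_isomorphic :: "'a set \<times> 'a set set \<Rightarrow> 'b set \<times> 'b set set \<Rightarrow> bool" where
  "graph_isomorphic G H \<longleftrightarrow>
     (\<exists>f. bij_betw f (fst G) (fst H) \<and>
        (\<forall>u \<in> fst G. \<forall>v \<in> fst G. {u, v} \<in> snd G \<longleftrightarrow> {f u, f v} \<in> snd H))"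

text \<open>The empty set and the polytope itself are faces in the sense of \<^const>\<open>face_of\<close>,
  so this is the full face lattice, ordered by inclusion.\<close>

definition face_lattice :: "'a::euclidean_space set \<Rightarrow> 'a set set" where
  "face_lattice P = {F. F face_of P}"

definition combinatorially_isomorphic ::
    "'a::euclidean_space set \<Rightarrow> 'b::euclidean_space set \<Rightarrow> bool" where
  "combinatorially_isomorphic P Q \<longleftrightarrow>
     (\<exists>\<phi>. bij_betw \<phi> (face_lattice P) (face_lattice Q) \<and>
        (\<forall>F \<in> face_lattice P. \<forall>G \<in> face_lattice P. F \<subseteq> G \<longleftrightarrow> \<phi> F \<subseteq> \<phi> G))"

end

theory Submission
  imports Defs
begin

text \<open>
  At a vertex of degree \<open>d\<close> every set of \<open>k\<close> neighbours spans a unique \<open>k\<close>-face. Following Kalai, we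
  count pairs of a 2-face and a local maximum of it that is a simple vertex, for an ordering of the
  vertices that puts a nonsimple vertex \<open>u2\<close> last. The count depends only on the graph. Every
  2-face avoiding \<open>u2\<close> contributes through its maximum, unless that is the other nonsimple
  vertex \<open>u1\<close>, and the orderings given by linear-fractional functions have no further local maxima.
  Such an ordering is therefore recognised in the graph, and if a 2-face avoiding \<open>u2\<close> is an initial
  segment of it, then that 2-face is recognised too. First one treats the 2-faces that contain
  \<open>u1\<close>, with \<open>u1\<close> as the minimum, so that all counts are under control for those that contain
  neither vertex. The 2-faces through both \<open>u1\<close> and \<open>u2\<close> are then forced at their simple vertices,
  because two 2-faces share at most an edge. Finally, a facet is determined by the neighbour that it
  omits at one simple vertex, since the 2-faces carry that neighbour along edges of the facet and the
  facet stays connected after deleting \<open>u1\<close> and \<open>u2\<close>.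
\<close>

section \<open>The cone spanned by the edges at a vertex\<close>

text \<open>At a nonsimple vertex two neighbours need not span a 2-face, so such vertices are barred
  from the count, and a 2-face whose maximum is nonsimple drops out of it. An order has two ends,
  and this makes two exceptions tractable: a vertex at the bottom is never the maximum of a 2-face,
  and a vertex at the top is lost only together with the 2-faces through it. The number of 2-faces
  avoiding \<open>u2\<close> is not visible in the graph, so an order that is geometric for one
  polytope is tested on the other, and the two unknown numbers are compared by inequalities in both
  directions. A linear function cannot in general put a given face first and a given vertex outside
  it last: in a regular hexagon take an edge and a vertex adjacent to one of its ends. A projective
  change of the function can. Nothing is assumed about the nonsimple vertices of \<open>Q\<close>;
  the graph isomorphism carries degree \<open>d\<close> over, and a vertex of degree
  \<open>d\<close> in a \<open>d\<close>-polytope is simple.\<close>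

definition nbr :: "'a::euclidean_space set \<Rightarrow> 'a \<Rightarrow> 'a set" where
  "nbr P v = {w \<in> vertices P. closed_segment v w edge_of P}"

lemma polytope_eq_hull_vertices: "polytope P \<Longrightarrow> P = convex hull (vertices P)"
  unfolding vertices_def
  by (intro Krein_Milman_Minkowski polytope_imp_compact polytope_imp_convex)

lemma finite_vertices: "polytope P \<Longrightarrow> finite (vertices P)"
  unfolding vertices_def by (simp add: finite_polyhedron_extreme_points polytope_imp_polyhedron)

lemma finite_nbr: "polytope P \<Longrightarrow> finite (nbr P v)"
  by (simp add: nbr_def finite_vertices)

lemma vertices_subset: "vertices P \<subseteq> P"
  by (auto simp: vertices_def extreme_point_of_def)

lemma vertices_face: "F face_of P \<Longrightarrow> vertices F = vertices P \<inter> F"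
  by (auto simp: vertices_def extreme_point_of_face)

lemma nbr_neq: "w \<in> nbr P v \<Longrightarrow> w \<noteq> v"
  by (auto simp: nbr_def edge_of_def)

lemma edge_of_face: "F face_of P \<Longrightarrow> e edge_of F \<longleftrightarrow> e edge_of P \<and> e \<subseteq> F"
  by (auto simp: edge_of_def face_of_face)

lemma nbr_face:
  assumes "F face_of P" "v \<in> F"
  shows "nbr F v = nbr P v \<inter> F"
proof -
  have "convex F" using assms(1) by (simp add: face_of_imp_convex)
  then have "closed_segment v w \<subseteq> F \<longleftrightarrow> w \<in> F" for w
    using assms(2) closed_segment_subset[of v F w] by auto
  then show ?thesis
    using assms by (auto simp: nbr_def vertices_face edge_of_face)
qed

lemma edge_eq_segment:
  assumes P: "polytope P" and e: "e edge_of P"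
  obtains a b where "a \<in> vertices P" "b \<in> vertices P" "a \<noteq> b" "e = closed_segment a b"
proof -
  have f: "e face_of P" and d: "aff_dim e = 1" using e by (auto simp: edge_of_def)
  have pe: "polytope e" using P f by (rule face_of_polytope_polytope)
  have "e \<noteq> {}" using d by auto
  then obtain a b where ab: "e = closed_segment a b"
    using compact_convex_collinear_segment[of e] pe d
    by (metis collinear_aff_dim order_refl polytope_imp_compact polytope_imp_convex)
  have "a \<noteq> b" using d ab by auto
  moreover have "a \<in> vertices P" "b \<in> vertices P"
    using vertices_face[OF f] extreme_point_of_segment[of _ a b] ab
    by (auto simp: vertices_def)
  ultimately show ?thesis using that ab by blast
qed

lemma edge_at_vertex:
  assumes P: "polytope P" and e: "e edge_of P" and v: "v \<in> vertices P" "v \<in> e"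
  obtains w where "w \<in> nbr P v" "e = closed_segment v w"
proof -
  obtain a b where ab: "a \<in> vertices P" "b \<in> vertices P" "a \<noteq> b" "e = closed_segment a b"
    using edge_eq_segment[OF P e] .
  have "v extreme_point_of e"
    using v e by (auto simp: vertices_def edge_of_def extreme_point_of_face)
  then have "v = a \<or> v = b" using ab(4) by (simp add: extreme_point_of_segment)
  then show ?thesis
  proof
    assume "v = a"
    then show ?thesis using that[of b] ab e by (simp add: nbr_def)
  next
    assume "v = b"
    then show ?thesis using that[of a] ab e by (simp add: nbr_def closed_segment_commute)
  qed
qed

text \<open>Among the finitely many faces through \<open>z\<close> take a minimal one; if
  \<open>z\<close> were on its relative frontier, a proper face of it through \<open>z\<close> would
  contradict minimality.\<close>

lemma obtain_face_rel_interior: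
  fixes P :: "'a::euclidean_space set"
  assumes "polytope P" "z \<in> P"
  obtains F where "F face_of P" "z \<in> rel_interior F"
proof -
  define Fs where "Fs = {F. F face_of P \<and> z \<in> F}"
  have "finite Fs" unfolding Fs_def
    by (rule finite_subset[OF _ finite_polytope_faces[OF assms(1)]]) auto
  moreover have "P \<in> Fs" using assms by (auto simp: Fs_def face_of_refl polytope_imp_convex)
  ultimately obtain F where F: "F \<in> Fs" "\<And>G. G \<in> Fs \<Longrightarrow> G \<subseteq> F \<Longrightarrow> G = F"
    by (metis finite_has_minimal empty_iff)
  have f: "F face_of P" "z \<in> F" using F(1) by (auto simp: Fs_def)
  have "polytope F" using f assms(1) face_of_polytope_polytope by blast
  then have poly: "polyhedron F" by (rule polytope_imp_polyhedron)
  have "z \<in> rel_interior F"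
  proof (rule ccontr)
    assume "z \<notin> rel_interior F"
    then have "z \<in> rel_frontier F"
      using f(2) closure_subset by (auto simp: rel_frontier_def)
    then obtain G where G: "G face_of F" "G \<noteq> F" "z \<in> G"
      using rel_frontier_of_polyhedron_alt[OF poly] by auto
    then have "G \<in> Fs" "G \<subseteq> F" using f(1) face_of_trans[OF G(1) f(1)] face_of_imp_subset[OF G(1)] by (auto simp: Fs_def)
    then show False using F(2) G(2) by blast
  qed
  then show ?thesis using that f by blast
qed

definition nbr_cone :: "'a::euclidean_space set \<Rightarrow> 'a \<Rightarrow> 'a set" where
  "nbr_cone P v = {\<Sum>w\<in>nbr P v. \<mu> w *\<^sub>R (w - v) | \<mu>. \<forall>w. 0 \<le> \<mu> w}"

lemma nbr_cone_add: "x \<in> nbr_cone P v \<Longrightarrow> y \<in> nbr_cone P v \<Longrightarrow> x + y \<in> nbr_cone P v"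
proof -
  assume "x \<in> nbr_cone P v" "y \<in> nbr_cone P v"
  then obtain \<mu> \<nu> where "x = (\<Sum>w\<in>nbr P v. \<mu> w *\<^sub>R (w - v))" "\<forall>w. 0 \<le> \<mu> w"
     "y = (\<Sum>w\<in>nbr P v. \<nu> w *\<^sub>R (w - v))" "\<forall>w. 0 \<le> \<nu> w"
    by (auto simp: nbr_cone_def)
  then have "x + y = (\<Sum>w\<in>nbr P v. (\<mu> w + \<nu> w) *\<^sub>R (w - v))" "\<forall>w. 0 \<le> \<mu> w + \<nu> w"
    by (auto simp: scaleR_left_distrib sum.distrib)
  then show ?thesis unfolding nbr_cone_def by (intro CollectI exI[of _ "\<lambda>w. \<mu> w + \<nu> w"]) simp
qed

lemma nbr_cone_scale: "x \<in> nbr_cone P v \<Longrightarrow> 0 \<le> c \<Longrightarrow> c *\<^sub>R x \<in> nbr_cone P v"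
proof -
  assume "x \<in> nbr_cone P v" "0 \<le> c"
  then obtain \<mu> where "x = (\<Sum>w\<in>nbr P v. \<mu> w *\<^sub>R (w - v))" "\<forall>w. 0 \<le> \<mu> w"
    by (auto simp: nbr_cone_def)
  then have "c *\<^sub>R x = (\<Sum>w\<in>nbr P v. (c * \<mu> w) *\<^sub>R (w - v))" "\<forall>w. 0 \<le> c * \<mu> w"
    using \<open>0 \<le> c\<close> by (auto simp: scaleR_sum_right)
  then show ?thesis unfolding nbr_cone_def by (intro CollectI exI[of _ "\<lambda>w. c * \<mu> w"]) simp
qed

lemma zero_in_nbr_cone: "0 \<in> nbr_cone P v"
  unfolding nbr_cone_def by (intro CollectI exI[of _ "\<lambda>w. 0"]) simp

lemma nbr_in_nbr_cone:
  assumes "polytope P" "w \<in> nbr P v" shows "w - v \<in> nbr_cone P v"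
proof -
  have "(\<Sum>u\<in>nbr P v. (if u = w then 1 else 0) *\<^sub>R (u - v)) = (\<Sum>u\<in>nbr P v. if u = w then u - v else 0)"
    by (rule sum.cong) auto
  also have "\<dots> = w - v" using assms by (simp add: sum.delta finite_nbr)
  finally show ?thesis
    unfolding nbr_cone_def by (intro CollectI exI[of _ "\<lambda>u. if u = w then 1 else 0"]) simp
qed

text \<open>Vertex figure argument: a hyperplane separating \<open>v\<close> from the other vertices
  cuts \<open>P\<close> in a slice whose extreme points lie on edges at \<open>v\<close>. Hence the
  slice lies in the translated cone, then \<open>K\<close> by scaling from \<open>v\<close>, then
  \<open>P\<close>.\<close>

lemma polytope_subset_nbr_cone:
  fixes P :: "'a::euclidean_space set"
  assumes P: "polytope P" and v: "v \<in> vertices P" and x: "x \<in> P"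
  shows "x - v \<in> nbr_cone P v"
proof -
  define K where "K = convex hull (vertices P - {v})"
  have hullV: "P = convex hull (insert v (vertices P - {v}))"
    using polytope_eq_hull_vertices[OF P] v by (simp add: insert_absorb)
  have KP: "K \<subseteq> P" unfolding K_def
    by (metis hull_mono polytope_eq_hull_vertices[OF P] Diff_subset)
  have vK: "v \<notin> K"
  proof
    assume "v \<in> K"
    then have "v extreme_point_of K"
      using v KP by (auto simp: vertices_def extreme_point_of_def subset_iff)
    then show False unfolding K_def using extreme_point_of_convex_hull by blast
  qed
  have ck: "compact K" "convex K"
    unfolding K_def using finite_vertices[OF P] finite_imp_compact_convex_hull by auto
  obtain a b where ab: "a \<bullet> v < b" "\<And>k. k \<in> K \<Longrightarrow> b < a \<bullet> k"
    using separating_hyperplane_closed_point[of K v] ck vK compact_imp_closed by metis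
  define S where "S = P \<inter> {z. a \<bullet> z = b}"
  have S: "compact S" "convex S" unfolding S_def
    using polytope_imp_compact[OF P] polytope_imp_convex[OF P]
    by (simp_all add: compact_Int_closed convex_Int closed_hyperplane convex_hyperplane)
  have ext: "z - v \<in> nbr_cone P v" if z: "z extreme_point_of S" for z
  proof -
    have zS: "z \<in> P" "a \<bullet> z = b" using z by (auto simp: extreme_point_of_def S_def)
    obtain F where F: "F face_of P" "z \<in> rel_interior F"
      using obtain_face_rel_interior[OF P zS(1)] .
    have zF: "z \<in> F" using F(2) rel_interior_subset by blast
    have pF: "polytope F" using face_of_polytope_polytope P F(1) by blast
    have "aff_dim F \<le> 1"
    proof (rule ccontr)
      assume "\<not> aff_dim F \<le> 1"
      \<comment> \<open>A face of dimension at least 2 meets the hyperplane in positive dimension,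
        so \<open>z\<close> could be moved both ways inside \<open>S\<close>; the step
        \<open>t\<close> below is scaled to stay within the ball around \<open>z\<close>.\<close>
      let ?A = "affine hull F \<inter> {x. a \<bullet> x = b}"
      have zA: "z \<in> ?A" using zF zS(2) by (simp add: hull_inc)
      then have "1 \<le> aff_dim ?A"
        using \<open>\<not> aff_dim F \<le> 1\<close> by (auto simp: aff_dim_affine_Int_hyperplane)
      then have "?A \<noteq> {z}" by auto
      then obtain y where y: "y \<in> ?A" "y \<noteq> z" using zA by blast
      obtain e where e: "e > 0" "cball z e \<inter> affine hull F \<subseteq> F"
        using F(2) by (auto simp: mem_rel_interior_cball)
      define t where "t = e / norm (y - z)"
      have t: "t > 0" using e(1) y(2) by (simp add: t_def)
      have aff: "z + s *\<^sub>R (y - z) \<in> affine hull F" for s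
      proof -
        have "z + s *\<^sub>R (y - z) = (1 - s) *\<^sub>R z + s *\<^sub>R y" by (simp add: algebra_simps)
        then show ?thesis
          using mem_affine[of "affine hull F" z y "1 - s" s] y(1) zA by (simp add: affine_affine_hull)
      qed
      have inS: "z + s *\<^sub>R (y - z) \<in> S" if "\<bar>s\<bar> = t" for s
      proof -
        have "norm (s *\<^sub>R (y - z)) = e" using that y(2) by (simp add: t_def)
        then have "z + s *\<^sub>R (y - z) \<in> cball z e" by (simp add: dist_norm)
        then have "z + s *\<^sub>R (y - z) \<in> P"
          using e(2) aff face_of_imp_subset[OF F(1)] by blast
        moreover have "a \<bullet> (z + s *\<^sub>R (y - z)) = b"
          using y(1) zS(2) by (simp add: inner_add_right inner_diff_right)
        ultimately show ?thesis by (simp add: S_def)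
      qed
      let ?p = "z + t *\<^sub>R (y - z)" and ?q = "z + (-t) *\<^sub>R (y - z)"
      have "?p \<in> S" "?q \<in> S" using inS[of t] inS[of "-t"] t by auto
      moreover have "?p \<noteq> ?q"
      proof -
        have "?p - ?q = (t + t) *\<^sub>R (y - z)" by (simp only: scaleR_left_distrib) simp
        moreover have "(t + t) *\<^sub>R (y - z) \<noteq> 0" using t y(2) by simp
        ultimately show ?thesis by (metis diff_self)
      qed
      moreover have "z = midpoint ?p ?q" by (simp add: midpoint_def algebra_simps flip: scaleR_add_left)
      ultimately show False
        using z midpoint_in_open_segment[of ?p ?q] unfolding extreme_point_of_def by metis
    qed
    have "aff_dim F \<noteq> 0"
    proof
      assume "aff_dim F = 0"
      then have "F = {z}" using zF by (auto simp: aff_dim_eq_0)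
      then have zv: "z \<in> vertices P" using F(1) by (simp add: vertices_def face_of_singleton)
      have "z \<noteq> v" using ab(1) zS(2) by auto
      then have "z \<in> K" using zv by (simp add: K_def hull_inc)
      then show False using ab(2) zS(2) by auto
    qed
    moreover have "aff_dim F \<noteq> -1" using zF by (metis aff_dim_empty empty_iff)
    moreover have "aff_dim F \<ge> -1" by (rule aff_dim_geq)
    ultimately have "aff_dim F = 1" using \<open>aff_dim F \<le> 1\<close> by linarith
    then have edge: "F edge_of P" using F(1) by (simp add: edge_of_def)
    obtain p q where pq: "p \<in> vertices P" "q \<in> vertices P" "p \<noteq> q" "F = closed_segment p q"
      using edge_eq_segment[OF P edge] .
    \<comment> \<open>An edge with both ends in the convex set \<open>K\<close> would stay strictly
      beyond the hyperplane.\<close>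
    have "v = p \<or> v = q"
    proof (rule ccontr)
      assume "\<not> (v = p \<or> v = q)"
      then have "p \<in> K" "q \<in> K" using pq by (auto simp: K_def hull_inc)
      then have "z \<in> K" using zF pq(4) ck(2) closed_segment_subset by blast
      then show False using ab(2) zS(2) by auto
    qed
    then have "v \<in> F" using pq(4) by auto
    then obtain w where w: "w \<in> nbr P v" "F = closed_segment v w"
      using edge_at_vertex[OF P edge v] by blast
    then obtain u where "0 \<le> u" "z = (1 - u) *\<^sub>R v + u *\<^sub>R w"
      using zF by (auto simp: in_segment)
    then have "z - v = u *\<^sub>R (w - v)" by (simp add: algebra_simps)
    then show ?thesis using nbr_cone_scale[OF nbr_in_nbr_cone[OF P w(1)] \<open>0 \<le> u\<close>] by simp
  qed
  have "convex ((+) v ` nbr_cone P v)"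
    by (intro convex_translation) (auto simp: convex_def intro: nbr_cone_add nbr_cone_scale)
  moreover have "{z. z extreme_point_of S} \<subseteq> (+) v ` nbr_cone P v"
  proof
    fix z assume "z \<in> {z. z extreme_point_of S}"
    then have "z - v \<in> nbr_cone P v" using ext by simp
    then have "v + (z - v) \<in> (+) v ` nbr_cone P v" by blast
    then show "z \<in> (+) v ` nbr_cone P v" by simp
  qed
  ultimately have "convex hull {z. z extreme_point_of S} \<subseteq> (+) v ` nbr_cone P v"
    by (simp add: hull_minimal)
  then have Scone: "z - v \<in> nbr_cone P v" if "z \<in> S" for z
    using that Krein_Milman_Minkowski[OF S] by auto
  have Kcone: "k - v \<in> nbr_cone P v" if k: "k \<in> K" for k
  proof -
    have akv: "0 < a \<bullet> k - a \<bullet> v" using ab k by fastforce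
    \<comment> \<open>The parameter at which the segment from \<open>v\<close> to \<open>k\<close>
      crosses the slice.\<close>
    define s where "s = (b - a \<bullet> v) / (a \<bullet> k - a \<bullet> v)"
    have s: "0 < s" "s \<le> 1" using ab(1) ab(2)[OF k] akv by (auto simp: s_def divide_le_eq)
    define z where "z = v + s *\<^sub>R (k - v)"
    have "z = (1 - s) *\<^sub>R v + s *\<^sub>R k" by (simp add: z_def algebra_simps)
    then have "z \<in> P"
      using convexD_alt[OF polytope_imp_convex[OF P], of v k s] s v k KP vertices_subset by auto
    moreover have "a \<bullet> z = b"
      using akv by (simp add: z_def inner_add_right inner_diff_right s_def)
    ultimately have "z - v \<in> nbr_cone P v" by (intro Scone) (simp add: S_def)
    then have "(1 / s) *\<^sub>R (z - v) \<in> nbr_cone P v" using s by (simp add: nbr_cone_scale)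
    then show ?thesis using s by (simp add: z_def)
  qed
  show ?thesis
  proof (cases "vertices P - {v} = {}")
    case True
    then have "P = {v}" using hullV by (metis convex_hull_singleton)
    then show ?thesis using x zero_in_nbr_cone[of P v] by simp
  next
    case False
    have "x \<in> convex hull (insert v (vertices P - {v}))" using x hullV by simp
    then obtain u k where "0 \<le> u" "k \<in> K" "x = (1 - u) *\<^sub>R v + u *\<^sub>R k"
      unfolding K_def convex_hull_insert_alt if_not_P[OF False] by blast
    then have "x - v = u *\<^sub>R (k - v)" by (simp add: algebra_simps)
    then show ?thesis using nbr_cone_scale Kcone \<open>0 \<le> u\<close> \<open>k \<in> K\<close> by metis
  qed
qed

text \<open>If no neighbour improved, \<open>c\<close> would be nonpositive on all generators of the
  cone, hence on \<open>x - v\<close>.\<close>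

lemma improving_nbr:
  assumes P: "polytope P" and v: "v \<in> vertices P" and x: "x \<in> P" "c \<bullet> v < c \<bullet> x"
  obtains w where "w \<in> nbr P v" "c \<bullet> v < c \<bullet> w"
proof -
  obtain \<mu> where \<mu>: "x - v = (\<Sum>w\<in>nbr P v. \<mu> w *\<^sub>R (w - v))" "\<And>w. 0 \<le> \<mu> w"
    using polytope_subset_nbr_cone[OF P v x(1)] by (auto simp: nbr_cone_def)
  have "\<exists>w\<in>nbr P v. c \<bullet> v < c \<bullet> w"
  proof (rule ccontr)
    assume "\<not> ?thesis"
    then have "\<And>w. w \<in> nbr P v \<Longrightarrow> c \<bullet> (w - v) \<le> 0" by (auto simp: inner_diff_right)
    then have "(\<Sum>w\<in>nbr P v. \<mu> w * (c \<bullet> (w - v))) \<le> 0"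
      using \<mu>(2) by (intro sum_nonpos) (simp add: mult_nonneg_nonpos)
    also have "(\<Sum>w\<in>nbr P v. \<mu> w * (c \<bullet> (w - v))) = c \<bullet> (x - v)"
      by (simp add: \<mu>(1) inner_sum_right)
    finally show False using x(2) by (simp add: inner_diff_right)
  qed
  then show ?thesis using that by blast
qed

section \<open>Faces at simple vertices\<close>

lemma nbr_cone_subset_span: "nbr_cone P v \<subseteq> span ((\<lambda>w. w - v) ` nbr P v)"
  by (auto simp: nbr_cone_def intro!: span_sum span_scale intro: span_base)

lemma polytope_subset_span_nbrs:
  assumes "polytope P" "v \<in> vertices P"
  shows "(\<lambda>x. x - v) ` P \<subseteq> span ((\<lambda>w. w - v) ` nbr P v)"
  using polytope_subset_nbr_cone[OF assms] nbr_cone_subset_span by blast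

lemma aff_dim_eq_dim_vertex:
  assumes "v \<in> vertices P"
  shows "aff_dim P = int (dim ((\<lambda>x. x - v) ` P))"
  using assms vertices_subset by (intro aff_dim_eq_dim_subtract) (auto intro: hull_inc)

lemma card_nbr_dirs: "card ((\<lambda>w. w - v) ` N) = card N" for v :: "'a::euclidean_space"
  by (intro card_image) (auto simp: inj_on_def)

lemma nbr_subset: "nbr P v \<subseteq> P"
  using vertices_subset by (auto simp: nbr_def)

lemma aff_dim_le_card_nbr:
  assumes "polytope P" "v \<in> vertices P"
  shows "aff_dim P \<le> int (card (nbr P v))"
proof -
  have "dim ((\<lambda>x. x - v) ` P) \<le> card ((\<lambda>w. w - v) ` nbr P v)"
    using polytope_subset_span_nbrs[OF assms] finite_nbr[OF assms(1)] by (intro dim_le_card) auto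
  then show ?thesis using aff_dim_eq_dim_vertex[OF assms(2)] by (simp add: card_nbr_dirs)
qed

text \<open>The neighbour directions span the direction space and are no more numerous than its
  dimension. This turns a degree, which the graph knows, into the linear form of simplicity.\<close>

lemma independent_nbrs:
  assumes "polytope P" "v \<in> vertices P" "aff_dim P = int (card (nbr P v))"
  shows "independent ((\<lambda>w. w - v) ` nbr P v)"
proof -
  let ?N = "(\<lambda>w. w - v) ` nbr P v"
  have "card ?N \<le> dim ((\<lambda>x. x - v) ` P)"
    using assms(3) aff_dim_eq_dim_vertex[OF assms(2)] by (simp add: card_nbr_dirs)
  then show ?thesis
    using polytope_subset_span_nbrs[OF assms(1,2)] finite_nbr[OF assms(1)] image_mono[OF nbr_subset[of P v], of "\<lambda>x. x - v"]
    by (intro card_le_dim_spanning[of ?N "(\<lambda>x. x - v) ` P"]) auto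
qed

lemma aff_dim_eq_card_nbr:
  assumes "polytope P" "v \<in> vertices P" "independent ((\<lambda>w. w - v) ` nbr P v)"
  shows "aff_dim P = int (card (nbr P v))"
proof -
  have "dim ((\<lambda>x. x - v) ` P) = card ((\<lambda>w. w - v) ` nbr P v)"
    by (intro dim_unique[of "(\<lambda>w. w - v) ` nbr P v"])
      (use assms polytope_subset_span_nbrs[OF assms(1,2)] image_mono[OF nbr_subset[of P v], of "\<lambda>x. x - v"] in auto)
  then show ?thesis using aff_dim_eq_dim_vertex[OF assms(2)] by (simp add: card_nbr_dirs)
qed

text \<open>The neighbours of \<open>v\<close> within the face inherit independence, so they count
  its dimension too.\<close>

lemma aff_dim_face_simple:
  assumes P: "polytope P" and v: "v \<in> vertices P" and ind: "independent ((\<lambda>w. w - v) ` nbr P v)"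
    and F: "F face_of P" "v \<in> F"
  shows "aff_dim F = int (card (nbr P v \<inter> F))"
proof -
  have "polytope F" "v \<in> vertices F"
    using face_of_polytope_polytope P F v by (auto simp: vertices_face)
  moreover have "independent ((\<lambda>w. w - v) ` (nbr P v \<inter> F))"
    by (rule independent_mono[OF ind]) auto
  ultimately show ?thesis
    using aff_dim_eq_card_nbr[of F v] nbr_face[OF F] by simp
qed

text \<open>Independence allows a functional to be prescribed on the neighbour directions: 0 towards
  \<open>B\<close>, -1 elsewhere. No neighbour improves it, so it is maximal at \<open>v\<close>,
  and its maximal face meets the neighbours exactly in \<open>B\<close>.\<close>

lemma simple_face_exists:
  assumes P: "polytope P" and v: "v \<in> vertices P" and ind: "independent ((\<lambda>w. w - v) ` nbr P v)"
    and B: "B \<subseteq> nbr P v"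
  obtains F where "F face_of P" "v \<in> F" "nbr P v \<inter> F = B"
proof -
  obtain f :: "'a \<Rightarrow> real" where f: "linear f"
    "\<And>y. y \<in> (\<lambda>w. w - v) ` nbr P v \<Longrightarrow> f y = (if y + v \<in> B then 0 else -1)"
    using linear_independent_extend[OF ind, of "\<lambda>y. if y + v \<in> B then 0 else -1"] by blast
  \<comment> \<open>The vector that represents \<open>f\<close> as an inner product.\<close>
  define c where "c = adjoint f 1"
  have cf: "c \<bullet> x = f x" for x
    unfolding c_def inner_commute[of _ x] adjoint_works[OF f(1)] by simp
  have c: "c \<bullet> (w - v) = (if w \<in> B then 0 else -1)" if "w \<in> nbr P v" for w
    unfolding cf f(2)[OF imageI[OF that]] by simp
  have le: "c \<bullet> x \<le> c \<bullet> v" if x: "x \<in> P" for x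
  proof (rule ccontr)
    assume "\<not> ?thesis"
    then have "c \<bullet> v < c \<bullet> x" by simp
    then obtain w where "w \<in> nbr P v" "c \<bullet> v < c \<bullet> w"
      using improving_nbr[OF P v x] by blast
    then show False using c[of w] by (simp add: inner_diff_right split: if_splits)
  qed
  have "P \<inter> {x. c \<bullet> x = c \<bullet> v} face_of P"
    using le by (intro face_of_Int_supporting_hyperplane_le polytope_imp_convex P)
  moreover have "nbr P v \<inter> (P \<inter> {x. c \<bullet> x = c \<bullet> v}) = B"
  proof -
    have "w \<in> P \<inter> {x. c \<bullet> x = c \<bullet> v} \<longleftrightarrow> w \<in> B" if "w \<in> nbr P v" for w
      using c[OF that] nbr_subset[of P v] that by (auto simp: inner_diff_right split: if_splits)
    then show ?thesis using B by blast
  qed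
  ultimately show ?thesis using that v vertices_subset by blast
qed

text \<open>An edge is an exposed face, and every other neighbour is a vertex off the edge, so the
  supporting functional is strictly smaller there.\<close>

lemma edge_functional:
  assumes P: "polytope P" and v: "v \<in> vertices P" and a: "a \<in> nbr P v"
  obtains c where "c \<bullet> (a - v) = 0" "\<And>b. b \<in> nbr P v \<Longrightarrow> b \<noteq> a \<Longrightarrow> c \<bullet> (b - v) < 0"
proof -
  let ?e = "closed_segment v a"
  have e: "?e face_of P" using a by (auto simp: nbr_def edge_of_def)
  then have "?e exposed_face_of P"
    using exposed_face_of_polyhedron[OF polytope_imp_polyhedron[OF P]] by simp
  then obtain c k where c: "P \<subseteq> {x. c \<bullet> x \<le> k}" "?e = P \<inter> {x. c \<bullet> x = k}"
    unfolding exposed_face_of_def by metis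
  have va: "c \<bullet> v = k" "c \<bullet> a = k" using c(2) by auto
  have "c \<bullet> (b - v) < 0" if b: "b \<in> nbr P v" "b \<noteq> a" for b
  proof -
    have "b extreme_point_of P" using b by (auto simp: nbr_def vertices_def)
    then have "b \<notin> ?e"
      using extreme_point_of_face[OF e, of b] extreme_point_of_segment[of b v a] b(2) nbr_neq[OF b(1)]
      by auto
    moreover have "b \<in> P" using b nbr_subset by blast
    ultimately have "c \<bullet> b < k" using c by force
    then show ?thesis using va by (simp add: inner_diff_right)
  qed
  moreover have "c \<bullet> (a - v) = 0" using va by (simp add: inner_diff_right)
  ultimately show ?thesis using that by blast
qed

lemma independent_two_nbrs:
  assumes P: "polytope P" and v: "v \<in> vertices P" and ab: "a \<in> nbr P v" "b \<in> nbr P v" "a \<noteq> b"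
  shows "independent {a - v, b - v}"
proof -
  obtain c where c: "c \<bullet> (a - v) = 0" "c \<bullet> (b - v) < 0"
    using edge_functional[OF P v ab(1)] ab by metis
  have "a - v \<noteq> 0" using nbr_neq ab by auto
  moreover have "b - v \<notin> span {a - v}"
    using c by (auto simp: span_singleton)
  ultimately show ?thesis
    using independent_insertI[of "b - v" "{a - v}"] by (simp add: insert_commute)
qed

text \<open>Serves to show that a nonsimple vertex needs dimension at least 3. The essential case is
  three neighbours in a plane: the functionals exposing two of the edges make the third direction a
  positive combination of the other two, which the functional exposing the third edge
  forbids.\<close>

lemma card_nbr_le_small_dim:
  assumes P: "polytope P" and v: "v \<in> vertices P" and d: "aff_dim P \<le> 2"
  shows "int (card (nbr P v)) \<le> aff_dim P"
proof (rule ccontr)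
  assume neg: "\<not> ?thesis"
  have dimP: "aff_dim P = int (dim ((\<lambda>x. x - v) ` P))" by (rule aff_dim_eq_dim_vertex[OF v])
  have in_dirs: "a - v \<in> (\<lambda>x. x - v) ` P" if "a \<in> nbr P v" for a
    using that nbr_subset by blast
  show False
  proof (cases "card (nbr P v) \<le> 2")
    case True
    have "independent ((\<lambda>w. w - v) ` nbr P v)"
    proof (cases "card (nbr P v) = 2")
      case True
      then obtain a b where "nbr P v = {a, b}" "a \<noteq> b" by (meson card_2_iff)
      then show ?thesis using independent_two_nbrs[OF P v, of a b] by simp
    next
      case False
      then have "card (nbr P v) = 0 \<or> card (nbr P v) = 1" using \<open>card (nbr P v) \<le> 2\<close> by linarith
      then consider "nbr P v = {}" | a where "nbr P v = {a}"
        using finite_nbr[OF P] by (metis card_0_eq card_1_singletonE)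
      then show ?thesis using nbr_neq[of _ P v] by cases (auto simp: independent_empty)
    qed
    then show False using aff_dim_eq_card_nbr[OF P v] neg by simp
  next
    case False
    then obtain S where S: "S \<subseteq> nbr P v" "card S = 3"
      using obtain_subset_with_card_n[of 3 "nbr P v"] by auto
    then obtain a b c where abc: "S = {a, b, c}" "a \<noteq> b" "b \<noteq> c" "a \<noteq> c"
      by (auto simp: card_3_iff)
    then have n: "a \<in> nbr P v" "b \<in> nbr P v" "c \<in> nbr P v" using S by auto
    have ind: "independent {a - v, b - v}" by (rule independent_two_nbrs[OF P v n(1,2) abc(2)])
    have "card {a - v, b - v} = 2" using abc(2) by simp
    then have "(\<lambda>x. x - v) ` P \<subseteq> span {a - v, b - v}"
      using ind d dimP in_dirs n by (intro card_ge_dim_independent) auto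
    then have "c - v \<in> span {a - v, b - v}" using in_dirs[OF n(3)] by blast
    then obtain \<alpha> \<beta> where "c - v - \<alpha> *\<^sub>R (a - v) = \<beta> *\<^sub>R (b - v)"
      unfolding span_breakdown_eq[of "c - v" "a - v" "{b - v}"] span_singleton by blast
    then have eq: "c - v = \<alpha> *\<^sub>R (a - v) + \<beta> *\<^sub>R (b - v)" by (simp add: diff_eq_eq add.commute)
    obtain f where f: "f \<bullet> (a - v) = 0" "f \<bullet> (b - v) < 0" "f \<bullet> (c - v) < 0"
      using edge_functional[OF P v n(1)] n abc by metis
    obtain g where g: "g \<bullet> (b - v) = 0" "g \<bullet> (a - v) < 0" "g \<bullet> (c - v) < 0"
      using edge_functional[OF P v n(2)] n abc by metis
    obtain h where h: "h \<bullet> (c - v) = 0" "h \<bullet> (a - v) < 0" "h \<bullet> (b - v) < 0"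
      using edge_functional[OF P v n(3)] n abc by metis
    have "\<beta> * (f \<bullet> (b - v)) < 0" using f(1,3) unfolding eq by (simp add: inner_add_right)
    then have "\<beta> > 0" using f(2) by (simp add: mult_less_0_iff)
    have "\<alpha> * (g \<bullet> (a - v)) < 0" using g(1,3) unfolding eq by (simp add: inner_add_right)
    then have "\<alpha> > 0" using g(2) by (simp add: mult_less_0_iff)
    have "\<alpha> * (h \<bullet> (a - v)) + \<beta> * (h \<bullet> (b - v)) = 0"
      using h(1) unfolding eq by (simp add: inner_add_right)
    moreover have "\<alpha> * (h \<bullet> (a - v)) < 0" "\<beta> * (h \<bullet> (b - v)) < 0"
      using h(2,3) \<open>\<alpha> > 0\<close> \<open>\<beta> > 0\<close> by (simp_all add: mult_pos_neg)
    ultimately show False by linarith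
  qed
qed

section \<open>Connectivity and shelling orders of the vertices\<close>

text \<open>Connectivity without paths: a nonempty part closed under neighbours is everything. The
  empty set counts as connected.\<close>

definition conn :: "('v \<Rightarrow> 'v \<Rightarrow> bool) \<Rightarrow> 'v set \<Rightarrow> bool" where
  "conn E X \<longleftrightarrow> (\<forall>Y\<subseteq>X. Y \<noteq> {} \<longrightarrow> (\<forall>y\<in>Y. \<forall>x\<in>X. E y x \<longrightarrow> x \<in> Y) \<longrightarrow> Y = X)"

lemma connD:
  assumes "conn E X" "Y \<subseteq> X" "Y \<noteq> {}" "\<And>y x. y \<in> Y \<Longrightarrow> x \<in> X \<Longrightarrow> E y x \<Longrightarrow> x \<in> Y"
  shows "Y = X"
  using assms unfolding conn_def by blast

abbreviation edge_rel :: "'a::euclidean_space set \<Rightarrow> 'a \<Rightarrow> 'a \<Rightarrow> bool" where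
  "edge_rel P v w \<equiv> closed_segment v w edge_of P"

lemma edge_rel_sym: "edge_rel P v w \<Longrightarrow> edge_rel P w v"
  by (simp add: closed_segment_commute)

lemma finite_has_argmax:
  fixes f :: "'v \<Rightarrow> real"
  assumes "finite Y" "Y \<noteq> {}"
  obtains y where "y \<in> Y" "\<And>x. x \<in> Y \<Longrightarrow> f x \<le> f y"
proof -
  have "Max (f ` Y) \<in> f ` Y" using assms by (intro Max_in) auto
  then obtain y where "y \<in> Y" "f y = Max (f ` Y)" by force
  then show ?thesis using that assms(1) by (metis Max_ge finite_imageI imageI)
qed

text \<open>Strict inequalities are open conditions and only finitely many are at stake;
  \<open>b\<close> is left to decide the ties of \<open>a\<close>.\<close>

lemma perturbation:
  fixes a b :: "'v \<Rightarrow> real"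
  assumes "finite V"
  obtains \<epsilon> where "\<epsilon> > 0"
    "\<And>x y. x \<in> V \<Longrightarrow> y \<in> V \<Longrightarrow> a x < a y \<Longrightarrow> a x + \<epsilon> * b x < a y + \<epsilon> * b y"
proof -
  have "\<forall>\<^sub>F \<epsilon> in at_right 0. a x < a y \<longrightarrow> a x + \<epsilon> * b x < a y + \<epsilon> * b y" for x y
  proof (cases "a x < a y")
    case True
    have "((\<lambda>\<epsilon>. a y + \<epsilon> * b y - (a x + \<epsilon> * b x)) \<longlongrightarrow> a y + 0 * b y - (a x + 0 * b x)) (at_right 0)"
      by (intro tendsto_intros)
    then have "\<forall>\<^sub>F \<epsilon> in at_right 0. 0 < a y + \<epsilon> * b y - (a x + \<epsilon> * b x)"
      using True by (intro order_tendstoD(1)) auto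
    then show ?thesis by (rule eventually_mono) simp
  qed simp
  then have "\<forall>\<^sub>F \<epsilon> in at_right 0. \<forall>x\<in>V. \<forall>y\<in>V. a x < a y \<longrightarrow> a x + \<epsilon> * b x < a y + \<epsilon> * b y"
    using assms by (simp add: eventually_ball_finite_distrib)
  moreover have "\<forall>\<^sub>F \<epsilon> :: real in at_right 0. 0 < \<epsilon>" by (rule eventually_at_right_less)
  ultimately have "\<forall>\<^sub>F \<epsilon> in at_right 0. 0 < \<epsilon> \<and> (\<forall>x\<in>V. \<forall>y\<in>V. a x < a y \<longrightarrow> a x + \<epsilon> * b x < a y + \<epsilon> * b y)"
    by eventually_elim simp
  then obtain \<epsilon> where "0 < \<epsilon>" "\<forall>x\<in>V. \<forall>y\<in>V. a x < a y \<longrightarrow> a x + \<epsilon> * b x < a y + \<epsilon> * b y"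
    using eventually_happens'[OF trivial_limit_at_right_real] by blast
  then show ?thesis using that by blast
qed

text \<open>Finitely many hyperplanes are negligible and so do not cover the space.\<close>

lemma generic_vector:
  fixes N :: "'a::euclidean_space set"
  assumes "finite N" "0 \<notin> N"
  obtains r where "\<And>n. n \<in> N \<Longrightarrow> r \<bullet> n \<noteq> 0"
proof -
  have "negligible (\<Union>n\<in>N. {x. n \<bullet> x = 0})"
    using assms by (intro negligible_Union) (auto intro!: negligible_hyperplane)
  then have "(\<Union>n\<in>N. {x. n \<bullet> x = 0}) \<noteq> UNIV" using non_negligible_UNIV by metis
  then obtain r where "\<forall>n\<in>N. n \<bullet> r \<noteq> 0" by blast
  then show ?thesis using that by (metis inner_commute)
qed

lemma improving_edge_rel:
  assumes "polytope P" "v \<in> vertices P" "x \<in> P" "c \<bullet> v < c \<bullet> x"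
  obtains w where "w \<in> vertices P" "edge_rel P v w" "c \<bullet> v < c \<bullet> w"
  using improving_nbr[OF assms] unfolding nbr_def by blast

text \<open>A perturbation \<open>c'\<close> of \<open>c\<close> separates the vertices without
  reversing strict inequalities. Edges improving \<open>c'\<close> never lower \<open>c\<close>, so
  they stay in the half-space; hence every nonempty neighbour-closed part contains the unique top
  vertex, and two complementary parts cannot both do so.\<close>

lemma conn_halfspace:
  assumes P: "polytope P"
  shows "conn (edge_rel P) {v \<in> vertices P. t < c \<bullet> v}"
proof -
  let ?V = "vertices P" and ?X = "{v \<in> vertices P. t < c \<bullet> v}"
  have fin: "finite ?V" by (rule finite_vertices[OF P])
  have "finite {x - y | x y. x \<in> ?V \<and> y \<in> ?V \<and> x \<noteq> y}"
    by (rule finite_subset[of _ "(\<lambda>(x, y). x - y) ` (?V \<times> ?V)"]) (use fin in auto)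
  then obtain r where r: "\<And>n. n \<in> {x - y | x y. x \<in> ?V \<and> y \<in> ?V \<and> x \<noteq> y} \<Longrightarrow> r \<bullet> n \<noteq> 0"
    using generic_vector[of "{x - y | x y. x \<in> ?V \<and> y \<in> ?V \<and> x \<noteq> y}"] by auto
  obtain \<epsilon> where e: "\<epsilon> > 0" "\<And>x y. x \<in> ?V \<Longrightarrow> y \<in> ?V \<Longrightarrow> c \<bullet> x < c \<bullet> y \<Longrightarrow>
      c \<bullet> x + \<epsilon> * (r \<bullet> x) < c \<bullet> y + \<epsilon> * (r \<bullet> y)"
    using perturbation[OF fin, of "\<lambda>x. c \<bullet> x" "\<lambda>x. r \<bullet> x"] by auto
  define c' where "c' = c + \<epsilon> *\<^sub>R r"
  have c': "c' \<bullet> x = c \<bullet> x + \<epsilon> * (r \<bullet> x)" for x by (simp add: c'_def inner_add_left)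
  have mono: "c' \<bullet> x < c' \<bullet> y" if "x \<in> ?V" "y \<in> ?V" "c \<bullet> x < c \<bullet> y" for x y
    using e(2) that by (simp add: c')
  have inj: "c' \<bullet> x \<noteq> c' \<bullet> y" if xy: "x \<in> ?V" "y \<in> ?V" "x \<noteq> y" for x y
  proof
    assume eq: "c' \<bullet> x = c' \<bullet> y"
    have "\<not> c \<bullet> x < c \<bullet> y" using mono[OF xy(1,2)] eq by auto
    moreover have "\<not> c \<bullet> y < c \<bullet> x" using mono[OF xy(2,1)] eq by auto
    ultimately have "c \<bullet> x = c \<bullet> y" by linarith
    then have "r \<bullet> x = r \<bullet> y" using eq e(1) by (simp add: c')
    then have "r \<bullet> (x - y) = 0" by (simp add: inner_diff_right)
    then show False using r xy by blast
  qed
  have top: "\<exists>y\<in>Y. \<forall>x\<in>?V. c' \<bullet> x \<le> c' \<bullet> y"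
    if Y: "Y \<subseteq> ?X" "Y \<noteq> {}" "\<forall>y\<in>Y. \<forall>x\<in>?X. edge_rel P y x \<longrightarrow> x \<in> Y" for Y
  proof -
    have "finite Y" by (rule finite_subset[OF _ fin]) (use Y(1) in auto)
    then obtain y where y: "y \<in> Y" "\<And>x. x \<in> Y \<Longrightarrow> c' \<bullet> x \<le> c' \<bullet> y"
      using finite_has_argmax[of Y "\<lambda>x. c' \<bullet> x"] Y(2) by blast
    have "c' \<bullet> x \<le> c' \<bullet> y" if x: "x \<in> ?V" for x
    proof (rule ccontr)
      assume "\<not> ?thesis"
      then have less: "c' \<bullet> y < c' \<bullet> x" by simp
      have yX: "y \<in> ?V" "t < c \<bullet> y" using y(1) Y(1) by auto
      have "x \<in> P" using x vertices_subset by blast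
      then obtain w where w: "w \<in> ?V" "edge_rel P y w" "c' \<bullet> y < c' \<bullet> w"
        using improving_edge_rel[OF P yX(1) _ less] by blast
      have "\<not> c \<bullet> w < c \<bullet> y" using mono[of w y] w yX by force
      then have "w \<in> ?X" using w(1) yX by simp
      then have "w \<in> Y" using Y(3) y(1) w(2) by blast
      then show False using y(2) w(3) by force
    qed
    then show ?thesis using y(1) by blast
  qed
  show ?thesis unfolding conn_def
  proof (intro allI impI, rule ccontr)
    fix Y assume Y: "Y \<subseteq> ?X" "Y \<noteq> {}" "\<forall>y\<in>Y. \<forall>x\<in>?X. edge_rel P y x \<longrightarrow> x \<in> Y" and "Y \<noteq> ?X"
    then have Z: "?X - Y \<subseteq> ?X" "?X - Y \<noteq> {}"
      "\<forall>y\<in>?X - Y. \<forall>x\<in>?X. edge_rel P y x \<longrightarrow> x \<in> ?X - Y"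
      using edge_rel_sym by blast+
    obtain y z where yz: "y \<in> Y" "\<forall>x\<in>?V. c' \<bullet> x \<le> c' \<bullet> y" "z \<in> ?X - Y" "\<forall>x\<in>?V. c' \<bullet> x \<le> c' \<bullet> z"
      using top[OF Y] top[OF Z] by blast
    then have "y \<in> ?V" "z \<in> ?V" "y \<noteq> z" using Y(1) by auto
    then show False using inj[of y z] yz by force
  qed
qed

lemma face_support:
  fixes P :: "'a::euclidean_space set"
  assumes P: "polytope P" and F: "F face_of P"
  obtains c k where "\<And>x. x \<in> P \<Longrightarrow> 0 \<le> c \<bullet> x + k" "\<And>x. x \<in> P \<Longrightarrow> c \<bullet> x + k = 0 \<longleftrightarrow> x \<in> F"
proof -
  have "F exposed_face_of P"
    using F exposed_face_of_polyhedron[OF polytope_imp_polyhedron[OF P]] by simp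
  then obtain c k where c: "P \<subseteq> {x. c \<bullet> x \<le> k}" "F = P \<inter> {x. c \<bullet> x = k}"
    unfolding exposed_face_of_def by metis
  show ?thesis
  proof (rule that[of "-c" k])
    show "0 \<le> (-c) \<bullet> x + k" if "x \<in> P" for x using c(1) that by auto
    show "(-c) \<bullet> x + k = 0 \<longleftrightarrow> x \<in> F" if "x \<in> P" for x using c(2) that by auto
  qed
qed

lemma conn_minus_face:
  assumes P: "polytope P" and F: "F face_of P"
  shows "conn (edge_rel P) (vertices P - F)"
proof -
  obtain c k where c: "\<And>x. x \<in> P \<Longrightarrow> 0 \<le> c \<bullet> x + k" "\<And>x. x \<in> P \<Longrightarrow> c \<bullet> x + k = 0 \<longleftrightarrow> x \<in> F"
    using face_support[OF P F] by blast
  have "vertices P - F = {v \<in> vertices P. -k < c \<bullet> v}"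
    using c vertices_subset[of P] by force
  then show ?thesis using conn_halfspace[OF P] by simp
qed

text \<open>\<open>z\<close> is a vertex on the level of \<open>x\<close> and \<open>y\<close> that
  survives the deletion. Both open sides are connected, each remaining vertex on the level has a
  neighbour above it, and \<open>z\<close> bridges the lower side, if there is one, to the
  upper.\<close>

lemma conn_minus_two_aux:
  assumes P: "polytope P" and z: "z \<in> vertices P" "z \<noteq> x" "z \<noteq> y"
    and c: "c \<bullet> x = t" "c \<bullet> y = t" "c \<bullet> z = t" and u: "u \<in> vertices P" "t < c \<bullet> u"
  shows "conn (edge_rel P) (vertices P - {x, y})"
  unfolding conn_def
proof (intro allI impI)
  let ?V = "vertices P - {x, y}"
  let ?U = "{v \<in> vertices P. t < c \<bullet> v}" and ?L = "{v \<in> vertices P. -t < (-c) \<bullet> v}"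
  fix Y assume Y: "Y \<subseteq> ?V" "Y \<noteq> {}" "\<forall>y\<in>Y. \<forall>x\<in>?V. edge_rel P y x \<longrightarrow> x \<in> Y"
  have sub: "?U \<subseteq> ?V" "?L \<subseteq> ?V" using c by auto
  have absorb: "W \<subseteq> Y" if "conn (edge_rel P) W" "W \<subseteq> ?V" "Y \<inter> W \<noteq> {}" for W
  proof -
    have "Y \<inter> W = W" using that Y(3) by (intro connD[OF that(1)]) blast+
    then show ?thesis by blast
  qed
  have absorbU: "?U \<subseteq> Y" if "Y \<inter> ?U \<noteq> {}" using absorb[OF conn_halfspace[OF P] sub(1) that] .
  have absorbL: "?L \<subseteq> Y" if "Y \<inter> ?L \<noteq> {}" using absorb[OF conn_halfspace[OF P] sub(2) that] .
  have up: "\<exists>w\<in>?U. edge_rel P v w" if "v \<in> vertices P" "c \<bullet> v = t" for v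
  proof -
    have "u \<in> P" "c \<bullet> v < c \<bullet> u" using u that(2) vertices_subset by auto
    then show ?thesis using improving_edge_rel[OF P that(1)] that(2) by (metis (lifting) mem_Collect_eq)
  qed
  have down: "\<exists>w\<in>?L. edge_rel P v w" if "v \<in> vertices P" "c \<bullet> v = t" and l: "l \<in> ?L" for v l
  proof -
    have "l \<in> P" "(-c) \<bullet> v < (-c) \<bullet> l" using that(2) l vertices_subset by auto
    then obtain w where "w \<in> vertices P" "edge_rel P v w" "(-c) \<bullet> v < (-c) \<bullet> w"
      using improving_edge_rel[OF P \<open>v \<in> vertices P\<close>] by blast
    then show ?thesis using that(2) by auto
  qed
  have zV: "z \<in> ?V" using z by auto
  have "Y \<inter> ?U \<noteq> {}"
  proof -
    obtain y where y: "y \<in> Y" using Y(2) by blast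
    consider "y \<in> ?U" | "y \<in> ?L" | "c \<bullet> y = t" using y Y(1) by fastforce
    then show ?thesis
    proof cases
      case 1 then show ?thesis using y by blast
    next
      case 2
      then obtain l where "l \<in> ?L" "edge_rel P z l" using down[of z y] z c by blast
      then have "z \<in> Y" using absorbL y 2 Y(3) zV edge_rel_sym by blast
      moreover obtain w where "w \<in> ?U" "edge_rel P z w" using up[of z] z c by blast
      ultimately show ?thesis using Y(3) sub by blast
    next
      case 3
      then obtain w where "w \<in> ?U" "edge_rel P y w" using up[of y] y Y(1) by blast
      then show ?thesis using Y(3) sub y by blast
    qed
  qed
  then have U: "?U \<subseteq> Y" by (rule absorbU)
  have eq: "v \<in> Y" if v: "v \<in> ?V" "c \<bullet> v = t" for v
  proof -
    obtain w where "w \<in> ?U" "edge_rel P v w" using up[of v] v by blast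
    then show ?thesis using U Y(3) v(1) edge_rel_sym by blast
  qed
  have "?L \<subseteq> Y"
  proof (cases "?L = {}")
    case False
    then obtain w where "w \<in> ?L" "edge_rel P z w" using down[of z] z c by blast
    then show ?thesis using absorbL eq[OF zV c(3)] Y(3) sub by blast
  qed blast
  then have "?V \<subseteq> Y" using U eq by fastforce
  then show "Y = ?V" using Y(1) by blast
qed

text \<open>Balinski's theorem for two deleted vertices. Dimension 3 leaves room for a linear
  function that agrees at \<open>x\<close>, \<open>y\<close> and a third vertex without being
  constant on \<open>P\<close>.\<close>

lemma conn_minus_two:
  fixes P :: "'a::euclidean_space set"
  assumes P: "polytope P" and d: "aff_dim P \<ge> 3"
  shows "conn (edge_rel P) (vertices P - {x, y})"
proof -
  let ?V = "vertices P"
  have one: "conn (edge_rel P) (?V - {z})" for z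
  proof (cases "z \<in> ?V")
    case True
    then have "{z} face_of P" by (simp add: vertices_def face_of_singleton)
    then show ?thesis using conn_minus_face[OF P] by simp
  next
    case False
    then show ?thesis using conn_minus_face[OF P empty_face_of] by simp
  qed
  show ?thesis
  proof (cases "x \<in> ?V \<and> y \<in> ?V")
    case False
    then have "?V - {x, y} = ?V - {x} \<or> ?V - {x, y} = ?V - {y}" by blast
    then show ?thesis using one by metis
  next
    case True
    have affV: "aff_dim ?V = aff_dim P"
      using polytope_eq_hull_vertices[OF P] by (metis aff_dim_convex_hull)
    have "\<not> ?V \<subseteq> {x, y}"
    proof
      assume "?V \<subseteq> {x, y}"
      then have "aff_dim ?V \<le> aff_dim {x, y}" by (rule aff_dim_subset)
      also have "\<dots> \<le> 1" by (simp add: aff_dim_2)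
      finally show False using affV d by simp
    qed
    then obtain z where z: "z \<in> ?V" "z \<noteq> x" "z \<noteq> y" by blast
    let ?S = "{y - x, z - x}" and ?T = "(\<lambda>p. p - x) ` P"
    have ST: "?S \<subseteq> ?T" using True z vertices_subset by blast
    have "dim ?S \<le> 2"
      using dim_le_card'[of ?S] card_insert_le_m1[of 2 "{z - x}" "y - x"] by simp
    moreover have "dim ?T \<ge> 3" using aff_dim_eq_dim_vertex[of x P] True d by simp
    ultimately have "dim (span ?S) \<noteq> dim (span ?T)" by simp
    then have "span ?S \<noteq> span ?T" by metis
    then have "span ?S \<subset> span ?T" using span_mono[OF ST] by blast
    \<comment> \<open>Taking \<open>c\<close> inside \<open>span ?T\<close> prevents it from being
      constant on \<open>P\<close>.\<close>
    then obtain c where c: "c \<noteq> 0" "c \<in> span ?T" "\<And>s. s \<in> span ?S \<Longrightarrow> orthogonal c s"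
      using orthogonal_to_subspace_exists_gen by blast
    have cyz: "c \<bullet> y = c \<bullet> x" "c \<bullet> z = c \<bullet> x"
      using c(3)[of "y - x"] c(3)[of "z - x"]
      by (auto simp: span_base orthogonal_def inner_diff_right)
    have "\<exists>u\<in>?V. c \<bullet> u \<noteq> c \<bullet> x"
    proof (rule ccontr)
      assume "\<not> ?thesis"
      then have "?V \<subseteq> {p. c \<bullet> p = c \<bullet> x}" by auto
      then have "P \<subseteq> {p. c \<bullet> p = c \<bullet> x}"
        by (metis polytope_eq_hull_vertices[OF P] hull_minimal convex_hyperplane)
      then have "?T \<subseteq> {p. c \<bullet> p = 0}" by (auto simp: inner_diff_right)
      then have "span ?T \<subseteq> {p. c \<bullet> p = 0}" by (intro span_minimal subspace_hyperplane)
      then show False using c(1,2) by auto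
    qed
    then obtain u where u: "u \<in> ?V" "c \<bullet> u \<noteq> c \<bullet> x" by blast
    then consider "c \<bullet> x < c \<bullet> u" | "(-c) \<bullet> x < (-c) \<bullet> u" by fastforce
    then show ?thesis
    proof cases
      case 1
      then show ?thesis using conn_minus_two_aux[OF P z refl cyz u(1)] by simp
    next
      case 2
      have "(-c) \<bullet> y = (-c) \<bullet> x" "(-c) \<bullet> z = (-c) \<bullet> x" using cyz by simp_all
      then show ?thesis using conn_minus_two_aux[OF P z refl _ _ u(1) 2] by blast
    qed
  qed
qed

section \<open>Linear-fractional orders of the vertices\<close>

text \<open>Linear functions seen through a projective transformation that is admissible for
  \<open>P\<close>: the denominator is positive on all of \<open>P\<close>.\<close>

definition lin_frac :: "'a::euclidean_space set \<Rightarrow> ('a \<Rightarrow> real) \<Rightarrow> bool" where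
  "lin_frac P g \<longleftrightarrow>
     (\<exists>c k c' k'. \<forall>x\<in>P. 0 < c' \<bullet> x + k' \<and> g x = (c \<bullet> x + k) / (c' \<bullet> x + k'))"

text \<open>Superlevel sets of a linear-fractional function are cut out by half-spaces.\<close>

lemma lin_frac_improving:
  assumes P: "polytope P" and g: "lin_frac P g" and v: "v \<in> vertices P" and x: "x \<in> P" "g v < g x"
  obtains w where "w \<in> vertices P" "edge_rel P v w" "g v < g w"
proof -
  obtain c k c' k' where g: "\<And>x. x \<in> P \<Longrightarrow> 0 < c' \<bullet> x + k' \<and> g x = (c \<bullet> x + k) / (c' \<bullet> x + k')"
    using g unfolding lin_frac_def by blast
  \<comment> \<open>Clearing the positive denominator turns \<open>g v < g y\<close> into a linear
    inequality with gradient \<open>?h\<close>.\<close>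
  let ?h = "c - g v *\<^sub>R c'"
  have vP: "v \<in> P" using v vertices_subset by blast
  have key: "g v < g y \<longleftrightarrow> ?h \<bullet> v < ?h \<bullet> y" if "y \<in> P" for y
  proof -
    have pos: "0 < c' \<bullet> y + k'" and gy: "g y = (c \<bullet> y + k) / (c' \<bullet> y + k')" using g[OF that] by auto
    have "g v * (c' \<bullet> v + k') = c \<bullet> v + k" using g[OF vP] by (metis less_irrefl nonzero_eq_divide_eq)
    moreover have "g v < g y \<longleftrightarrow> g v * (c' \<bullet> y + k') < c \<bullet> y + k"
      using pos by (simp add: gy less_divide_eq)
    ultimately show ?thesis unfolding inner_diff_left inner_scaleR_left distrib_left by linarith
  qed
  obtain w where "w \<in> vertices P" "edge_rel P v w" "?h \<bullet> v < ?h \<bullet> w"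
    using improving_edge_rel[OF P v x(1)] key[OF x(1)] x(2) by blast
  then show ?thesis using that key[of w] vertices_subset by blast
qed

lemma lin_frac_subset: "lin_frac P g \<Longrightarrow> F \<subseteq> P \<Longrightarrow> lin_frac F g"
  unfolding lin_frac_def by (meson subsetD)

text \<open>The numerator vanishes on \<open>F\<close>, and the denominator is nearly zero at \<open>w\<close>, which makes \<open>w\<close> the
  last vertex. Small perturbations of the numerator then put \<open>E\<close> first inside \<open>F\<close> and break ties.\<close>

lemma shelling_function_exists:
  fixes P :: "'a::euclidean_space set"
  assumes P: "polytope P" and E: "E face_of P" and F: "F face_of P" and EF: "E \<subseteq> F"
    and w: "w \<in> vertices P" "w \<notin> F"
  obtains g where "lin_frac P g" "inj_on g (vertices P)"
    "\<And>x y. x \<in> vertices P \<inter> E \<Longrightarrow> y \<in> vertices P - E \<Longrightarrow> g x < g y"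
    "\<And>x y. x \<in> vertices P \<inter> F \<Longrightarrow> y \<in> vertices P - F \<Longrightarrow> g x < g y"
    "\<And>y. y \<in> vertices P - {w} \<Longrightarrow> g y < g w"
proof -
  let ?V = "vertices P"
  have fin: "finite ?V" by (rule finite_vertices[OF P])
  have VP: "x \<in> P" if "x \<in> ?V" for x using that vertices_subset by blast
  obtain cF kF where hF: "\<And>x. x \<in> P \<Longrightarrow> 0 \<le> cF \<bullet> x + kF" "\<And>x. x \<in> P \<Longrightarrow> cF \<bullet> x + kF = 0 \<longleftrightarrow> x \<in> F"
    using face_support[OF P F] by blast
  obtain cE kE where hE: "\<And>x. x \<in> P \<Longrightarrow> 0 \<le> cE \<bullet> x + kE" "\<And>x. x \<in> P \<Longrightarrow> cE \<bullet> x + kE = 0 \<longleftrightarrow> x \<in> E"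
    using face_support[OF P E] by blast
  have "{w} face_of P" using w(1) by (simp add: vertices_def face_of_singleton)
  then obtain cw kw where hw: "\<And>x. x \<in> P \<Longrightarrow> 0 \<le> cw \<bullet> x + kw"
      "\<And>x. x \<in> P \<Longrightarrow> cw \<bullet> x + kw = 0 \<longleftrightarrow> x \<in> {w}"
    using face_support[OF P] by metis
  define M where "M = (\<Sum>x\<in>?V - {w}. (cF \<bullet> x + kF) / (cw \<bullet> x + kw))"
  have M: "(cF \<bullet> x + kF) / (cw \<bullet> x + kw) \<le> M" if "x \<in> ?V - {w}" for x
    unfolding M_def using that fin hF(1) hw(1) VP by (intro member_le_sum) auto
  have "0 \<le> M" unfolding M_def using hF(1) hw(1) VP by (intro sum_nonneg) auto
  have hFw: "0 < cF \<bullet> w + kF" using hF[OF VP[OF w(1)]] w(2) by force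
  \<comment> \<open>At \<open>w\<close> the denominator \<open>D\<close> is exactly \<delta>, so
    this choice makes \<open>a0 w\<close> equal to \<open>M + 1\<close>, above all the other
    values.\<close>
  define \<delta> where "\<delta> = (cF \<bullet> w + kF) / (M + 1)"
  have \<delta>: "0 < \<delta>" using hFw \<open>0 \<le> M\<close> by (simp add: \<delta>_def)
  define D where "D x = cw \<bullet> x + (kw + \<delta>)" for x
  have D: "0 < D x" if "x \<in> P" for x using hw(1)[OF that] \<delta> by (simp add: D_def)
  define a0 where "a0 x = (cF \<bullet> x + kF) / D x" for x
  have a0w: "a0 y < a0 w" if y: "y \<in> ?V - {w}" for y
  proof -
    have pos: "0 < cw \<bullet> y + kw" using hw[of y] y VP by force
    have "a0 y \<le> (cF \<bullet> y + kF) / (cw \<bullet> y + kw)"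
      unfolding a0_def D_def using pos \<delta> hF(1)[of y] VP y by (intro divide_left_mono) auto
    also have "\<dots> \<le> M" by (rule M[OF y])
    also have "\<dots> < M + 1" by simp
    also have "\<dots> = a0 w"
    proof -
      have "D w = \<delta>" using hw(2)[OF VP[OF w(1)]] by (simp add: D_def)
      then show ?thesis using hFw \<open>0 \<le> M\<close> by (simp add: a0_def \<delta>_def)
    qed
    finally show ?thesis .
  qed
  have a0F: "a0 x = 0" if "x \<in> ?V \<inter> F" for x using that hF(2) VP by (simp add: a0_def)
  have a0nF: "0 < a0 x" if "x \<in> ?V - F" for x
    using that hF[of x] D[of x] VP[of x] by (simp add: a0_def order_less_le)
  obtain \<epsilon> where e: "\<epsilon> > 0" "\<And>x y. x \<in> ?V \<Longrightarrow> y \<in> ?V \<Longrightarrow> a0 x < a0 y \<Longrightarrow>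
      a0 x + \<epsilon> * ((cE \<bullet> x + kE) / D x) < a0 y + \<epsilon> * ((cE \<bullet> y + kE) / D y)"
    using perturbation[OF fin, of a0 "\<lambda>x. (cE \<bullet> x + kE) / D x"] by blast
  \<comment> \<open>On \<open>F\<close> the term \<open>a0\<close> vanishes, so there the second
    term decides alone, and it is zero exactly on \<open>E\<close>; strict inequalities of
    \<open>a0\<close> persist.\<close>
  define a1 where "a1 x = a0 x + \<epsilon> * ((cE \<bullet> x + kE) / D x)" for x
  have a1: "a1 x < a1 y" if "x \<in> ?V" "y \<in> ?V" "a0 x < a0 y" for x y
    using e(2) that by (simp add: a1_def)
  have a1E: "a1 x < a1 y" if x: "x \<in> ?V \<inter> E" and y: "y \<in> ?V - E" for x y
  proof (cases "y \<in> F")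
    case True
    have "a1 x = 0" using x a0F[of x] EF hE(2)[of x] VP by (auto simp: a1_def)
    moreover have "0 < cE \<bullet> y + kE" using hE[of y] y VP[of y] by (simp add: order_less_le)
    then have "0 < a1 y" using a0F[of y] True y e(1) D[of y] VP[of y] by (simp add: a1_def)
    ultimately show ?thesis by simp
  next
    case False
    then show ?thesis using a1[of x y] a0F[of x] a0nF[of y] x y EF by auto
  qed
  \<comment> \<open>After cross-multiplication, a tie of \<open>b\<close> at \<open>x\<close> and
    \<open>y\<close> says that \<open>(r, \<rho>)\<close> is orthogonal to such a vector; a generic
    pair avoids all ties.\<close>
  define N where "N = {(D y *\<^sub>R x - D x *\<^sub>R y, D y - D x) | x y. x \<in> ?V \<and> y \<in> ?V \<and> x \<noteq> y}"
  have "finite N" unfolding N_def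
    by (rule finite_subset[of _ "(\<lambda>(x, y). (D y *\<^sub>R x - D x *\<^sub>R y, D y - D x)) ` (?V \<times> ?V)"])
      (use fin in auto)
  moreover have "0 \<notin> N"
  proof
    assume "0 \<in> N"
    then obtain x y where xy: "x \<in> ?V" "x \<noteq> y" "D y *\<^sub>R x = D x *\<^sub>R y" "D y = D x"
      by (auto simp: N_def zero_prod_def)
    then show False using D[of x] VP by auto
  qed
  ultimately obtain r\<rho> where r: "\<And>n. n \<in> N \<Longrightarrow> r\<rho> \<bullet> n \<noteq> 0" using generic_vector by blast
  obtain r \<rho> where rr: "r\<rho> = (r, \<rho>)" by force
  define b where "b x = (r \<bullet> x + \<rho>) / D x" for x
  have b: "b x \<noteq> b y" if xy: "x \<in> ?V" "y \<in> ?V" "x \<noteq> y" for x y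
  proof
    assume "b x = b y"
    then have "(r \<bullet> x + \<rho>) * D y = (r \<bullet> y + \<rho>) * D x"
      using D[of x] D[of y] VP xy by (simp add: b_def frac_eq_eq)
    then have "r\<rho> \<bullet> (D y *\<^sub>R x - D x *\<^sub>R y, D y - D x) = 0"
      by (simp add: rr inner_diff_right algebra_simps)
    then show False using r xy unfolding N_def by blast
  qed
  obtain \<epsilon>' where e': "\<epsilon>' > 0" "\<And>x y. x \<in> ?V \<Longrightarrow> y \<in> ?V \<Longrightarrow> a1 x < a1 y \<Longrightarrow>
      a1 x + \<epsilon>' * b x < a1 y + \<epsilon>' * b y"
    using perturbation[OF fin, of a1 b] by blast
  define g where "g x = a1 x + \<epsilon>' * b x" for x
  have g1: "g x < g y" if "x \<in> ?V" "y \<in> ?V" "a1 x < a1 y" for x y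
    using e'(2) that by (simp add: g_def)
  show ?thesis
  proof (rule that)
    have "g x = ((cF + \<epsilon> *\<^sub>R cE + \<epsilon>' *\<^sub>R r) \<bullet> x + (kF + \<epsilon> * kE + \<epsilon>' * \<rho>)) / (cw \<bullet> x + (kw + \<delta>))" for x
      unfolding g_def a1_def a0_def b_def D_def
      by (simp add: inner_add_left algebra_simps add_divide_distrib)
    then show "lin_frac P g"
      unfolding lin_frac_def using D unfolding D_def by blast
    show "inj_on g ?V"
    proof (rule inj_onI, rule ccontr)
      fix x y assume xy: "x \<in> ?V" "y \<in> ?V" "g x = g y" "x \<noteq> y"
      have "\<not> a1 x < a1 y" using g1[OF xy(1,2)] xy(3) by auto
      moreover have "\<not> a1 y < a1 x" using g1[OF xy(2,1)] xy(3) by auto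
      ultimately have "a1 x = a1 y" by linarith
      then show False using xy b e'(1) by (simp add: g_def)
    qed
    show "g x < g y" if "x \<in> ?V \<inter> E" "y \<in> ?V - E" for x y
      using a1E that by (auto intro: g1)
    show "g x < g y" if "x \<in> ?V \<inter> F" "y \<in> ?V - F" for x y
      using a0F a0nF that by (auto intro!: g1 a1)
    show "g y < g w" if "y \<in> ?V - {w}" for y
      using a0w that w(1) by (auto intro!: g1 a1)
  qed
qed

section \<open>Reconstruction of the 2-faces\<close>

text \<open>The combinatorial residue of the geometry: both polytopes, labelled alike, become such
  systems over the same \<open>W\<close> and \<open>E\<close>, and only \<open>T\<close> can differ.
  In the orders of the last two axioms a local maximum of a 2-face is its maximum.\<close>

locale two_face_system =
  fixes W :: "'v set" and E :: "'v \<Rightarrow> 'v \<Rightarrow> bool" and u1 u2 :: 'v and T :: "'v set set"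
  assumes finite_W: "finite W"
    and E_sym: "E x y \<Longrightarrow> E y x"
    and E_irrefl: "\<not> E x x"
    and E_W: "E x y \<Longrightarrow> x \<in> W"
    and u_W: "u1 \<in> W" "u2 \<in> W"
    and T_subset: "F \<in> T \<Longrightarrow> F \<subseteq> W"
    and face_exists: "v \<in> W \<Longrightarrow> v \<noteq> u1 \<Longrightarrow> v \<noteq> u2 \<Longrightarrow> E v a \<Longrightarrow> E v b \<Longrightarrow> a \<noteq> b \<Longrightarrow>
        \<exists>F\<in>T. v \<in> F \<and> {w \<in> F. E v w} = {a, b}"
    and face_degree: "F \<in> T \<Longrightarrow> v \<in> F \<Longrightarrow> v \<noteq> u1 \<Longrightarrow> v \<noteq> u2 \<Longrightarrow> card {w \<in> F. E v w} = 2"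
    and face_Int: "F \<in> T \<Longrightarrow> G \<in> T \<Longrightarrow> F \<noteq> G \<Longrightarrow> x \<in> F \<inter> G \<Longrightarrow> y \<in> F \<inter> G \<Longrightarrow> x \<noteq> y \<Longrightarrow>
        F \<inter> G = {x, y} \<and> E x y"
    and conn_minus1: "F \<in> T \<Longrightarrow> conn E (F - {x})"
    and conn_minus_edge: "F \<in> T \<Longrightarrow> x \<in> F \<Longrightarrow> y \<in> F \<Longrightarrow> E x y \<Longrightarrow> conn E (F - {x, y})"
    and not_small: "F \<in> T \<Longrightarrow> \<not> F \<subseteq> {x, y}"
    and order_exists: "x \<in> W \<Longrightarrow> y \<in> W \<Longrightarrow> x \<noteq> y \<Longrightarrow>
        \<exists>g :: 'v \<Rightarrow> real. inj_on g W
          \<and> (\<forall>F\<in>T. \<forall>v\<in>F. (\<forall>w\<in>F. E v w \<longrightarrow> g w < g v) \<longrightarrow> (\<forall>w\<in>F. g w \<le> g v))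
          \<and> (\<forall>v\<in>W - {x}. g x < g v) \<and> (\<forall>v\<in>W - {y}. g v < g y)"
    and order_exists_face: "F \<in> T \<Longrightarrow> x \<in> F \<Longrightarrow> y \<in> W - F \<Longrightarrow>
        \<exists>g :: 'v \<Rightarrow> real. inj_on g W
          \<and> (\<forall>F\<in>T. \<forall>v\<in>F. (\<forall>w\<in>F. E v w \<longrightarrow> g w < g v) \<longrightarrow> (\<forall>w\<in>F. g w \<le> g v))
          \<and> (\<forall>v\<in>W - {x}. g x < g v) \<and> (\<forall>v\<in>W - {y}. g v < g y)
          \<and> (\<forall>a\<in>F. \<forall>b\<in>W - F. g a < g b)"
begin

definition good :: "('v \<Rightarrow> real) \<Rightarrow> bool" where
  "good g \<longleftrightarrow> inj_on g W \<and>
     (\<forall>F\<in>T. \<forall>v\<in>F. (\<forall>w\<in>F. E v w \<longrightarrow> g w < g v) \<longrightarrow> (\<forall>w\<in>F. g w \<le> g v))"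

definition sinks :: "('v \<Rightarrow> real) \<Rightarrow> ('v \<times> 'v set) set" where
  "sinks g = {(v, F). F \<in> T \<and> v \<in> F \<and> v \<noteq> u1 \<and> v \<noteq> u2 \<and> (\<forall>w\<in>F. E v w \<longrightarrow> g w < g v)}"

text \<open>Under every injective order these pairs are sinks, so their number is a lower bound for
  the sinks. \<open>u2\<close> is excluded through the face and \<open>u1\<close> through the
  vertex, which leaves the simple maxima.\<close>

definition tops :: "('v \<Rightarrow> real) \<Rightarrow> ('v \<times> 'v set) set" where
  "tops g = {(v, F). F \<in> T \<and> u2 \<notin> F \<and> v \<in> F \<and> v \<noteq> u1 \<and> (\<forall>w\<in>F. g w \<le> g v)}"

definition topped :: "('v \<Rightarrow> real) \<Rightarrow> 'v set set" where
  "topped g = {F \<in> T. u2 \<notin> F \<and> (\<exists>v\<in>F. v \<noteq> u1 \<and> (\<forall>w\<in>F. g w \<le> g v))}"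

lemma finite_face: "F \<in> T \<Longrightarrow> finite F"
  using T_subset finite_W finite_subset by blast

lemma finite_T: "finite T"
  using finite_W T_subset by (meson PowI finite_Pow_iff finite_subset subsetI)

lemma face_eqI:
  assumes "F \<in> T" "G \<in> T" "x \<in> F \<inter> G" "y \<in> F \<inter> G" "z \<in> F \<inter> G" "x \<noteq> y" "z \<noteq> x" "z \<noteq> y"
  shows "F = G"
  using face_Int[OF assms(1,2) _ assms(3,4,6)] assms by blast

lemma face_eqI_nbrs:
  assumes "F \<in> T" "G \<in> T" "v \<in> F" "v \<in> G" "v \<noteq> u1" "v \<noteq> u2" "{w \<in> F. E v w} \<subseteq> G"
  shows "F = G"
proof -
  obtain a b where ab: "{w \<in> F. E v w} = {a, b}" "a \<noteq> b"
    using face_degree[OF assms(1,3,5,6)] by (meson card_2_iff)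
  then have "E v a" "E v b" "a \<in> F" "b \<in> F" by auto
  then have "v \<noteq> a" "v \<noteq> b" using E_irrefl by auto
  then show ?thesis
    using face_eqI[OF assms(1,2), of a b v] ab \<open>a \<in> F\<close> \<open>b \<in> F\<close> assms(3,4,7) by blast
qed

text \<open>Deleting \<open>y\<close> keeps the 2-face connected, so \<open>x\<close> can be
  isolated in the rest only if nothing else is left.\<close>

lemma nbr_in_face:
  assumes "F \<in> T" "x \<in> F" "x \<noteq> y"
  obtains z where "z \<in> F" "z \<noteq> y" "E x z"
proof -
  have "\<exists>z\<in>F - {y}. E x z"
  proof (rule ccontr)
    assume neg: "\<not> ?thesis"
    have "{x} = F - {y}"
      using assms neg by (intro connD[OF conn_minus1[OF assms(1), of y]]) auto
    then show False using not_small[OF assms(1), of x y] by blast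
  qed
  then show ?thesis using that by blast
qed

lemma finite_sinks: "finite (sinks g)"
proof (rule finite_subset)
  show "sinks g \<subseteq> W \<times> T" using T_subset by (auto simp: sinks_def)
qed (use finite_W finite_T in auto)

text \<open>Since every pair of neighbours of a simple vertex spans a unique 2-face, the number of
  sinks depends only on the graph.\<close>

lemma card_sinks:
  "card (sinks g) = card {(v, B). v \<in> W \<and> v \<noteq> u1 \<and> v \<noteq> u2 \<and> card B = 2 \<and>
     (\<forall>w\<in>B. E v w \<and> g w < g v)}"
proof (rule bij_betw_same_card)
  let ?f = "\<lambda>(v, F). (v, {w \<in> F. E v w})"
  let ?C = "{(v, B). v \<in> W \<and> v \<noteq> u1 \<and> v \<noteq> u2 \<and> card B = 2 \<and> (\<forall>w\<in>B. E v w \<and> g w < g v)}"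
  show "bij_betw ?f (sinks g) ?C"
  proof (rule bij_betw_imageI)
    show "inj_on ?f (sinks g)"
    proof (rule inj_onI)
      fix p q assume s: "p \<in> sinks g" "q \<in> sinks g" and eq: "?f p = ?f q"
      obtain v F G where pq: "p = (v, F)" "q = (v, G)" using eq by (cases p; cases q) auto
      then have "{w \<in> F. E v w} \<subseteq> G" using eq by auto
      then show "p = q"
        using face_eqI_nbrs[of F G v] s pq by (simp add: sinks_def)
    qed
    show "?f ` sinks g = ?C"
    proof
      show "?f ` sinks g \<subseteq> ?C"
        using face_degree T_subset by (auto simp: sinks_def)
      show "?C \<subseteq> ?f ` sinks g"
      proof clarify
        fix v B assume v: "v \<in> W" "v \<noteq> u1" "v \<noteq> u2" "card B = 2"
          and B: "\<forall>w\<in>B. E v w \<and> g w < g v"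
        obtain a b where ab: "B = {a, b}" "a \<noteq> b" using v(4) by (meson card_2_iff)
        then obtain F where F: "F \<in> T" "v \<in> F" "{w \<in> F. E v w} = B"
          using face_exists[OF v(1-3), of a b] B by auto
        then have "(v, F) \<in> sinks g" using B v by (auto simp: sinks_def)
        then have "?f (v, F) \<in> ?f ` sinks g" by (rule imageI)
        then show "(v, B) \<in> ?f ` sinks g" using F(3) by simp
      qed
    qed
  qed
qed

lemma tops_subset_sinks:
  assumes "inj_on g W" shows "tops g \<subseteq> sinks g"
proof clarify
  fix v F assume t: "(v, F) \<in> tops g"
  then have "F \<subseteq> W" using T_subset by (auto simp: tops_def)
  moreover have "g w < g v" if "w \<in> F" "E v w" for w
  proof -
    have "w \<noteq> v" using that(2) E_irrefl by auto
    then have "g w \<noteq> g v" using assms t that(1) \<open>F \<subseteq> W\<close> by (auto simp: tops_def inj_on_def)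
    then show ?thesis using t that(1) by (force simp: tops_def)
  qed
  ultimately show "(v, F) \<in> sinks g" using t by (auto simp: tops_def sinks_def)
qed

lemma card_tops:
  assumes "inj_on g W" shows "card (tops g) = card (topped g)"
proof (rule bij_betw_same_card[of snd])
  show "bij_betw snd (tops g) (topped g)"
  proof (rule bij_betw_imageI)
    show "inj_on snd (tops g)"
    proof (rule inj_onI)
      fix p q assume t: "p \<in> tops g" "q \<in> tops g" "snd p = snd q"
      obtain v v' F where pq: "p = (v, F)" "q = (v', F)" using t(3) by (cases p; cases q) auto
      then have "v \<in> F" "v' \<in> F" "F \<subseteq> W" "g v \<le> g v'" "g v' \<le> g v"
        using t(1,2) T_subset by (auto simp: tops_def)
      then have "v = v'" using assms by (meson antisym inj_onD subsetD)
      then show "p = q" using pq by simp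
    qed
    show "snd ` tops g = topped g" by (force simp: tops_def topped_def)
  qed
qed

text \<open>In a good order a sink is the maximum of its 2-face, and with \<open>u2\<close> on top
  no 2-face through \<open>u2\<close> has a simple maximum.\<close>

lemma sinks_eq_tops:
  assumes "good g" "\<And>v. v \<in> W \<Longrightarrow> v \<noteq> u2 \<Longrightarrow> g v < g u2"
  shows "sinks g = tops g"
proof
  show "tops g \<subseteq> sinks g" using assms(1) tops_subset_sinks by (auto simp: good_def)
  show "sinks g \<subseteq> tops g"
  proof clarify
    fix v F assume s: "(v, F) \<in> sinks g"
    then have max: "\<forall>w\<in>F. g w \<le> g v" using assms(1) by (auto simp: good_def sinks_def)
    have "g v < g u2" using s assms(2) T_subset by (auto simp: sinks_def)
    then have "u2 \<notin> F" using max by force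
    then show "(v, F) \<in> tops g" using s max by (auto simp: tops_def sinks_def)
  qed
qed

text \<open>This recognises an order without geometry: an inclusion of finite sets with equal
  cardinalities is an equality.\<close>

lemma sinks_eq_tops_card:
  assumes "inj_on g W" "card (sinks g) = card (topped g)"
  shows "sinks g = tops g"
  using card_subset_eq[OF finite_sinks tops_subset_sinks[OF assms(1)]] card_tops assms by simp

lemma card_topped_le:
  assumes "inj_on g W" shows "card (topped g) \<le> card (sinks g)"
  using card_mono[OF finite_sinks tops_subset_sinks[OF assms]] card_tops[OF assms] by simp

lemma face_argmax:
  assumes "F \<in> T"
  obtains v where "v \<in> F" "\<And>w. w \<in> F \<Longrightarrow> g w \<le> (g v :: real)"
proof (rule finite_has_argmax[of F g])
  show "F \<noteq> {}" using not_small[OF assms] by auto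
qed (use finite_face[OF assms] that in auto)

text \<open>The condition on \<open>g\<close> is an implication so as to cover both the 2-faces
  avoiding \<open>u1\<close> and the orders that start at \<open>u1\<close>.\<close>

lemma face_argmax_neq_u1:
  assumes F: "F \<in> T" and first: "u1 \<in> F \<Longrightarrow> \<forall>v\<in>W - {u1}. g u1 < g v"
  obtains v where "v \<in> F" "v \<noteq> u1" "\<And>w. w \<in> F \<Longrightarrow> g w \<le> (g v :: real)"
proof -
  obtain v where v: "v \<in> F" "\<And>w. w \<in> F \<Longrightarrow> g w \<le> g v" using face_argmax[OF F] by blast
  have "v \<noteq> u1"
  proof
    assume "v = u1"
    obtain w where "w \<in> F" "w \<noteq> u1" using not_small[OF F, of u1 u1] by blast
    moreover have "u1 \<in> F" using v(1) \<open>v = u1\<close> by simp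
    ultimately have "g u1 < g w" using first T_subset[OF F] by blast
    then show False using v(2)[OF \<open>w \<in> F\<close>] \<open>v = u1\<close> by simp
  qed
  then show ?thesis using that v by blast
qed

lemma topped_first:
  assumes "\<forall>v\<in>W - {u1}. g u1 < g v"
  shows "topped g = {F \<in> T. u2 \<notin> F}"
proof -
  have "\<exists>v\<in>F. v \<noteq> u1 \<and> (\<forall>w\<in>F. g w \<le> g v)" if F: "F \<in> T" for F
    by (rule face_argmax_neq_u1[OF F, of g]) (use assms in auto)
  then show ?thesis unfolding topped_def by auto
qed

text \<open>Only 2-faces through \<open>u1\<close> can drop out, by having their maximum there; this
  isolates the part of the count that depends on \<open>g\<close>.\<close>

lemma topped_split:
  "topped g = {F \<in> T. u1 \<in> F \<and> u2 \<notin> F \<and> (\<exists>v\<in>F. v \<noteq> u1 \<and> (\<forall>w\<in>F. g w \<le> g v))}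
     \<union> {F \<in> T. u1 \<notin> F \<and> u2 \<notin> F}"
proof -
  have "\<exists>v\<in>F. v \<noteq> u1 \<and> (\<forall>w\<in>F. g w \<le> g v)" if F: "F \<in> T" "u1 \<notin> F" for F
    by (rule face_argmax_neq_u1[OF F(1), of g]) (use F in auto)
  then show ?thesis unfolding topped_def by auto
qed

end

section \<open>Comparison of two systems over the same graph\<close>

locale two_systems =
  A: two_face_system W E u1 u2 T + B: two_face_system W E u1 u2 T'
  for W :: "'v set" and E u1 u2 T T' +
  assumes u_neq: "u1 \<noteq> u2"

text \<open>The axioms are symmetric in the exceptional vertices, so results on 2-faces avoiding
  \<open>u2\<close> carry over to those avoiding \<open>u1\<close>.\<close>

lemma two_face_system_swap: "two_face_system W E u1 u2 T \<Longrightarrow> two_face_system W E u2 u1 T"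
proof -
  assume "two_face_system W E u1 u2 T"
  then interpret two_face_system W E u1 u2 T .
  show ?thesis
    by (rule two_face_system.intro;
        (rule finite_W E_irrefl u_W
         | (rule E_sym E_W T_subset face_exists face_degree face_Int conn_minus1 conn_minus_edge
              not_small order_exists order_exists_face; assumption)))
qed

lemma two_systems_swap_u: "two_systems W E u1 u2 T T' \<Longrightarrow> two_systems W E u2 u1 T T'"
  by (auto simp: two_systems_def two_systems_axioms_def two_face_system_swap)

lemma two_systems_swap: "two_systems W E u1 u2 T T' \<Longrightarrow> two_systems W E u1 u2 T' T"
  by (auto simp: two_systems_def)

context two_systems
begin

lemma sinks_eq_tops_transfer:
  assumes "A.good g" "\<And>v. v \<in> W \<Longrightarrow> v \<noteq> u2 \<Longrightarrow> g v < g u2"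
    and "card (A.topped g) = card (B.topped g)"
  shows "B.sinks g = B.tops g"
proof -
  have inj: "inj_on g W" using assms(1) by (simp add: A.good_def)
  have "card (A.sinks g) = card (A.topped g)"
    using A.sinks_eq_tops[OF assms(1,2)] A.card_tops[OF inj] by simp
  then show ?thesis
    using B.sinks_eq_tops_card[OF inj] assms(3) A.card_sinks B.card_sinks by simp
qed

text \<open>At a simple vertex of a 2-face all its neighbours in the 2-face are determined by
  inclusion, so \<open>G\<close> swallows the connected set \<open>F - {u1}\<close>.\<close>

lemma face_eq_of_subset:
  assumes F: "F \<in> T" and G: "G \<in> T'" and sub: "G \<subseteq> F" and u2: "u2 \<notin> F"
  shows "G = F"
proof -
  have nb: "{w \<in> G. E v w} = {w \<in> F. E v w}" if "v \<in> G" "v \<noteq> u1" for v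
  proof (rule card_subset_eq)
    have "v \<noteq> u2" "v \<in> F" using that sub u2 by auto
    then show "card {w \<in> G. E v w} = card {w \<in> F. E v w}"
      using A.face_degree[OF F] B.face_degree[OF G] that by simp
  qed (use sub A.finite_face[OF F] in auto)
  have eq: "G - {u1} = F - {u1}"
  proof (rule connD[OF A.conn_minus1[OF F]])
    show "G - {u1} \<noteq> {}" using B.not_small[OF G, of u1 u1] by auto
    show "x \<in> G - {u1}" if "y \<in> G - {u1}" "x \<in> F - {u1}" "E y x" for x y
      using nb[of y] that by blast
  qed (use sub in blast)
  have "u1 \<in> G" if u1: "u1 \<in> F"
  proof -
    obtain v where v: "v \<in> F" "v \<noteq> u1" "E u1 v"
      using A.nbr_in_face[OF F u1 u_neq] A.E_irrefl by metis
    then have "v \<in> G" using eq by blast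
    then show ?thesis using nb[of v] v u1 A.E_sym by blast
  qed
  then show ?thesis using eq sub by blast
qed

text \<open>In \<open>T'\<close> the neighbours of the maximum \<open>v\<close> of \<open>F\<close>
  span some \<open>G\<close>, in which \<open>v\<close> is a sink and so, by the transferred
  equality, the maximum. As \<open>F\<close> is initial, everything below \<open>v\<close> lies in
  \<open>F\<close>, hence so does \<open>G\<close>.\<close>

lemma initial_face_transfer:
  assumes F: "F \<in> T" and u2: "u2 \<notin> F"
    and g: "A.good g" "\<forall>v\<in>W - {u2}. g v < g u2" "\<forall>a\<in>F. \<forall>b\<in>W - F. g a < g b"
    and first: "u1 \<in> F \<Longrightarrow> \<forall>v\<in>W - {u1}. g u1 < g v"
    and card: "card (A.topped g) = card (B.topped g)"
  shows "F \<in> T'"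
proof -
  have BT: "B.sinks g = B.tops g" using sinks_eq_tops_transfer[OF g(1) _ card] g(2) by blast
  obtain v where v: "v \<in> F" "v \<noteq> u1" "\<And>w. w \<in> F \<Longrightarrow> g w \<le> g v"
    using A.face_argmax_neq_u1[OF F first] by blast
  have vW: "v \<in> W" "v \<noteq> u2" using v A.T_subset[OF F] u2 by auto
  obtain a b where ab: "{w \<in> F. E v w} = {a, b}" "a \<noteq> b"
    using A.face_degree[OF F v(1,2) vW(2)] by (meson card_2_iff)
  have vab: "E v a" "E v b" using ab by auto
  then obtain G where G: "G \<in> T'" "v \<in> G" "{w \<in> G. E v w} = {a, b}"
    using B.face_exists[OF vW(1) v(2) vW(2)] ab(2) by blast
  have "(v, F) \<in> A.tops g" using F u2 v by (auto simp: A.tops_def)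
  then have "(v, F) \<in> A.sinks g" using A.tops_subset_sinks g(1) by (auto simp: A.good_def)
  then have "\<forall>w\<in>G. E v w \<longrightarrow> g w < g v" using G(3) ab by (auto simp: A.sinks_def)
  then have "(v, G) \<in> B.sinks g" using G v vW by (auto simp: B.sinks_def)
  then have max: "\<forall>w\<in>G. g w \<le> g v" using BT by (auto simp: B.tops_def)
  have "G \<subseteq> F"
  proof
    fix w assume w: "w \<in> G"
    then have "w \<in> W" using B.T_subset[OF G(1)] by blast
    then show "w \<in> F" using g(3) v(1) max w by (meson DiffI not_le)
  qed
  then show ?thesis using face_eq_of_subset[OF F G(1) _ u2] G(1) by simp
qed

text \<open>An order geometric for \<open>T\<close> attains the lower bound in \<open>T\<close>,
  while \<open>T'\<close> merely obeys it; the number of sinks is common to both.\<close>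

lemma card_avoiding_le: "card {F \<in> T'. u2 \<notin> F} \<le> card {F \<in> T. u2 \<notin> F}"
proof -
  obtain g :: "'v \<Rightarrow> real" where g: "A.good g" "\<forall>v\<in>W - {u1}. g u1 < g v" "\<forall>v\<in>W - {u2}. g v < g u2"
    using A.order_exists[OF A.u_W u_neq] unfolding A.good_def by blast
  have inj: "inj_on g W" using g(1) by (simp add: A.good_def)
  have "card {F \<in> T'. u2 \<notin> F} = card (B.topped g)" using B.topped_first[OF g(2)] by simp
  also have "\<dots> \<le> card (B.sinks g)" by (rule B.card_topped_le[OF inj])
  also have "\<dots> = card (A.sinks g)" by (simp add: A.card_sinks B.card_sinks)
  also have "\<dots> = card (A.topped g)"
    using A.sinks_eq_tops[OF g(1)] g(3) A.card_tops[OF inj] by simp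
  also have "\<dots> = card {F \<in> T. u2 \<notin> F}" using A.topped_first[OF g(2)] by simp
  finally show ?thesis .
qed

end

lemma (in two_systems) card_avoiding_eq: "card {F \<in> T'. u2 \<notin> F} = card {F \<in> T. u2 \<notin> F}"
  using card_avoiding_le two_systems.card_avoiding_le[OF two_systems_swap[OF two_systems_axioms]]
  by (rule antisym)

text \<open>With \<open>u1\<close> first no 2-face has its maximum there, so the topped 2-faces are
  all those avoiding \<open>u2\<close>, whose numbers already agree.\<close>

lemma (in two_systems) face_only_u1:
  assumes F: "F \<in> T" "u1 \<in> F" "u2 \<notin> F" shows "F \<in> T'"
proof -
  obtain g :: "'v \<Rightarrow> real" where g: "A.good g" "\<forall>v\<in>W - {u1}. g u1 < g v" "\<forall>v\<in>W - {u2}. g v < g u2"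
     "\<forall>a\<in>F. \<forall>b\<in>W - F. g a < g b"
    using A.order_exists_face[OF F(1,2), of u2] A.u_W F(3) unfolding A.good_def by blast
  show ?thesis
    using initial_face_transfer[OF F(1,3) g(1,3,4) g(2)] card_avoiding_eq
      A.topped_first[OF g(2)] B.topped_first[OF g(2)] by simp
qed

text \<open>\<open>u1\<close> lies outside the initial face and cannot be first, so 2-faces through
  it may drop out of the count. Those avoiding \<open>u2\<close> are already known to be the same in
  both systems, so they drop out equally.\<close>

lemma (in two_systems) face_no_u:
  assumes F: "F \<in> T" "u1 \<notin> F" "u2 \<notin> F" shows "F \<in> T'"
proof -
  have K: "{F \<in> T. u1 \<in> F \<and> u2 \<notin> F} = {F \<in> T'. u1 \<in> F \<and> u2 \<notin> F}"
    using face_only_u1 two_systems.face_only_u1[OF two_systems_swap[OF two_systems_axioms]] by blast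
  have split: "card {F \<in> S. u2 \<notin> F} = card {F \<in> S. u1 \<in> F \<and> u2 \<notin> F} + card {F \<in> S. u1 \<notin> F \<and> u2 \<notin> F}"
    if "finite S" for S :: "'v set set"
  proof -
    have "{F \<in> S. u2 \<notin> F} = {F \<in> S. u1 \<in> F \<and> u2 \<notin> F} \<union> {F \<in> S. u1 \<notin> F \<and> u2 \<notin> F}" by blast
    then show ?thesis using that by (simp add: card_Un_disjoint disjoint_iff)
  qed
  have N: "card {F \<in> T. u1 \<notin> F \<and> u2 \<notin> F} = card {F \<in> T'. u1 \<notin> F \<and> u2 \<notin> F}"
    using card_avoiding_eq split[OF A.finite_T] split[OF B.finite_T] K by simp
  obtain x where x: "x \<in> F" using A.not_small[OF F(1)] by blast
  obtain g :: "'v \<Rightarrow> real" where g: "A.good g" "\<forall>v\<in>W - {u2}. g v < g u2"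
     "\<forall>a\<in>F. \<forall>b\<in>W - F. g a < g b"
    using A.order_exists_face[OF F(1) x, of u2] A.u_W F(3) unfolding A.good_def by blast
  have K': "{F \<in> T. u1 \<in> F \<and> u2 \<notin> F \<and> (\<exists>v\<in>F. v \<noteq> u1 \<and> (\<forall>w\<in>F. g w \<le> g v))}
      = {F \<in> T'. u1 \<in> F \<and> u2 \<notin> F \<and> (\<exists>v\<in>F. v \<noteq> u1 \<and> (\<forall>w\<in>F. g w \<le> g v))}"
    using K by blast
  have "card (A.topped g) = card {F \<in> T. u1 \<in> F \<and> u2 \<notin> F \<and> (\<exists>v\<in>F. v \<noteq> u1 \<and> (\<forall>w\<in>F. g w \<le> g v))}
      + card {F \<in> T. u1 \<notin> F \<and> u2 \<notin> F}"
    unfolding A.topped_split using A.finite_T by (subst card_Un_disjoint) auto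
  moreover have "card (B.topped g) = card {F \<in> T'. u1 \<in> F \<and> u2 \<notin> F \<and> (\<exists>v\<in>F. v \<noteq> u1 \<and> (\<forall>w\<in>F. g w \<le> g v))}
      + card {F \<in> T'. u1 \<notin> F \<and> u2 \<notin> F}"
    unfolding B.topped_split using B.finite_T by (subst card_Un_disjoint) auto
  ultimately have "card (A.topped g) = card (B.topped g)" using N K' by simp
  then show ?thesis using initial_face_transfer[OF F(1,3) g] F(2) by blast
qed

lemma (in two_systems) face_not_both:
  assumes F: "F \<in> T" "\<not> (u1 \<in> F \<and> u2 \<in> F)" shows "F \<in> T'"
  using assms face_only_u1 face_no_u
    two_systems.face_only_u1[OF two_systems_swap_u[OF two_systems_axioms]] by blast

text \<open>If the 2-face \<open>G\<close> spanned in \<open>T'\<close> missed \<open>u1\<close> or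
  \<open>u2\<close>, it would already belong to \<open>T\<close>, where it shares three vertices
  with \<open>F\<close> and would equal it.\<close>

lemma (in two_systems) face_both_at:
  assumes F: "F \<in> T" "u1 \<in> F" "u2 \<in> F" and v: "v \<in> F" "v \<noteq> u1" "v \<noteq> u2"
  obtains G where "G \<in> T'" "u1 \<in> G" "u2 \<in> G" "v \<in> G" "{w \<in> G. E v w} = {w \<in> F. E v w}"
proof -
  have vW: "v \<in> W" using v A.T_subset[OF F(1)] by auto
  obtain a b where ab: "{w \<in> F. E v w} = {a, b}" "a \<noteq> b"
    using A.face_degree[OF F(1) v] by (meson card_2_iff)
  then have "E v a" "E v b" by auto
  then obtain G where G: "G \<in> T'" "v \<in> G" "{w \<in> G. E v w} = {a, b}"
    using B.face_exists[OF vW v(2,3)] ab(2) by blast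
  have "u1 \<in> G \<and> u2 \<in> G"
  proof (rule ccontr)
    assume neg: "\<not> ?thesis"
    then have "G \<in> T"
      using two_systems.face_not_both[OF two_systems_swap[OF two_systems_axioms] G(1)] by blast
    then have "F = G" using A.face_eqI_nbrs[OF F(1) _ v(1) G(2) v(2,3)] G(3) ab(1) by blast
    then show False using neg F by blast
  qed
  then show ?thesis using that G ab(1) by blast
qed

text \<open>The local candidates must be one and the same 2-face. If \<open>u1\<close> and
  \<open>u2\<close> are adjacent, the candidate at a vertex of \<open>G\<close> shares three
  vertices with \<open>G\<close>, and \<open>F\<close> minus the edge is connected; otherwise two
  distinct 2-faces cannot both contain the nonadjacent \<open>u1\<close> and
  \<open>u2\<close>.\<close>

lemma (in two_systems) face_both_subset:
  assumes F: "F \<in> T" "u1 \<in> F" "u2 \<in> F"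
  obtains G where "G \<in> T'" "u1 \<in> G" "u2 \<in> G" "F \<subseteq> G"
proof -
  obtain v where v: "v \<in> F" "v \<noteq> u1" "v \<noteq> u2" using A.not_small[OF F(1), of u1 u2] by blast
  obtain G where G: "G \<in> T'" "u1 \<in> G" "u2 \<in> G" "v \<in> G" "{w \<in> G. E v w} = {w \<in> F. E v w}"
    using face_both_at[OF F v] .
  have "F - {u1, u2} \<subseteq> G"
  proof (cases "E u1 u2")
    case True
    have "G \<inter> (F - {u1, u2}) = F - {u1, u2}"
    proof (rule connD[OF A.conn_minus_edge[OF F True]])
      fix y x assume y: "y \<in> G \<inter> (F - {u1, u2})" and x: "x \<in> F - {u1, u2}" "E y x"
      obtain H where H: "H \<in> T'" "u1 \<in> H" "u2 \<in> H" "y \<in> H" "{w \<in> H. E y w} = {w \<in> F. E y w}"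
        using face_both_at[OF F, of y] y by blast
      have "G = H" using B.face_eqI[OF G(1) H(1), of u1 u2 y] G H y u_neq by blast
      then show "x \<in> G \<inter> (F - {u1, u2})" using H(5) x by blast
    qed (use v G in blast)+
    then show ?thesis by blast
  next
    case False
    show ?thesis
    proof
      fix y assume y: "y \<in> F - {u1, u2}"
      obtain H where H: "H \<in> T'" "u1 \<in> H" "u2 \<in> H" "y \<in> H" "{w \<in> H. E y w} = {w \<in> F. E y w}"
        using face_both_at[OF F, of y] y by blast
      have "G = H" using B.face_Int[OF G(1) H(1) _ _ _ u_neq] False G H by blast
      then show "y \<in> G" using H(4) by simp
    qed
  qed
  then show ?thesis using that G by blast
qed

lemma (in two_systems) face_transfer:
  assumes F: "F \<in> T" shows "F \<in> T'"
proof (cases "u1 \<in> F \<and> u2 \<in> F")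
  case True
  then obtain G where G: "G \<in> T'" "u1 \<in> G" "u2 \<in> G" "F \<subseteq> G" using face_both_subset[OF F] by blast
  obtain H where H: "H \<in> T" "u1 \<in> H" "u2 \<in> H" "G \<subseteq> H"
    using two_systems.face_both_subset[OF two_systems_swap[OF two_systems_axioms] G(1-3)] .
  obtain v where v: "v \<in> F" "v \<noteq> u1" "v \<noteq> u2" using A.not_small[OF F, of u1 u2] by blast
  \<comment> \<open>The inclusions of \<open>F\<close> in \<open>G\<close> and of \<open>G\<close>
    in \<open>H\<close> close up: \<open>F\<close> and \<open>H\<close> lie in the same system and
    share three vertices.\<close>
  have "F = H" using A.face_eqI[OF F H(1), of u1 u2 v] v True H G(4) u_neq by blast
  then show ?thesis using G(1,4) H(4) by simp
qed (use face_not_both F in blast)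

lemma (in two_systems) systems_eq: "T = T'"
  using face_transfer two_systems.face_transfer[OF two_systems_swap[OF two_systems_axioms]] by blast

section \<open>Reconstruction of the facets\<close>

text \<open>Here \<open>facet_conn\<close> allows any two vertices to be deleted, which can
  disconnect a polygon; the axioms are meant for facets of dimension at least 3.\<close>

locale facet_system = two_face_system W E u1 u2 T
  for W :: "'v set" and E u1 u2 T +
  fixes \<Phi> :: "'v set set"
  assumes facet_subset: "A \<in> \<Phi> \<Longrightarrow> A \<subseteq> W"
    and facet_exists: "v \<in> W \<Longrightarrow> v \<noteq> u1 \<Longrightarrow> v \<noteq> u2 \<Longrightarrow> E v x \<Longrightarrow> \<exists>A\<in>\<Phi>. v \<in> A \<and> {w. E v w} - A = {x}"
    and facet_omits: "A \<in> \<Phi> \<Longrightarrow> v \<in> A \<Longrightarrow> v \<noteq> u1 \<Longrightarrow> v \<noteq> u2 \<Longrightarrow> \<exists>x. {w. E v w} - A = {x}"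
    and facet_Int: "A \<in> \<Phi> \<Longrightarrow> F \<in> T \<Longrightarrow> \<not> F \<subseteq> A \<Longrightarrow> x \<in> F \<inter> A \<Longrightarrow> y \<in> F \<inter> A \<Longrightarrow> x \<noteq> y \<Longrightarrow>
        F \<inter> A = {x, y}"
    and facet_conn: "A \<in> \<Phi> \<Longrightarrow> conn E (A - {x, y})"
    and facet_not_small: "A \<in> \<Phi> \<Longrightarrow> \<not> A \<subseteq> {x, y}"
    and facet_antichain: "A \<in> \<Phi> \<Longrightarrow> B \<in> \<Phi> \<Longrightarrow> A \<subseteq> B \<Longrightarrow> A = B"
begin

lemma facet_nbr:
  assumes "A \<in> \<Phi>" "x \<in> A" "x \<noteq> y"
  obtains z where "z \<in> A" "z \<noteq> y" "E x z"
proof -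
  \<comment> \<open>\<open>facet_conn\<close> deletes a pair; repeating \<open>y\<close> deletes a
    single vertex.\<close>
  have "\<exists>z\<in>A - {y, y}. E x z"
  proof (rule ccontr)
    assume neg: "\<not> ?thesis"
    have "{x} = A - {y, y}"
      using assms neg by (intro connD[OF facet_conn[OF assms(1), of y y]]) auto
    then show False using facet_not_small[OF assms(1), of x y] by blast
  qed
  then show ?thesis using that by blast
qed

text \<open>The 2-face through an edge \<open>v v'\<close> of the facet and the omitted neighbour \<open>x\<close> of \<open>v\<close>
  meets the facet exactly in that edge, so it contains the omitted neighbour of \<open>v'\<close>.\<close>

lemma omitted_nbr_step:
  assumes A: "A \<in> \<Phi>" "v \<in> A" "v' \<in> A" "E v v'" "{w. E v w} - A = {x}"
    and v': "v' \<noteq> u1" "v' \<noteq> u2"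
    and F: "F \<in> T" "v \<in> F" "v' \<in> F" "x \<in> F" and x': "{w \<in> F. E v' w} = {v, x'}" "x' \<noteq> v"
  shows "{w. E v' w} - A = {x'}"
proof -
  have "v \<noteq> v'" using A(4) E_irrefl by auto
  then have "F \<inter> A = {v, v'}" using facet_Int[OF A(1) F(1), of v v'] A F by blast
  moreover have "x' \<in> F" "E v' x'" using x' by auto
  ultimately have "x' \<in> {w. E v' w} - A" using x'(2) E_irrefl[of v'] by auto
  moreover obtain y where "{w. E v' w} - A = {y}" using facet_omits[OF A(1,3) v'] by blast
  ultimately show ?thesis by simp
qed

text \<open>At one simple vertex \<open>B\<close> is chosen to omit the same neighbour as
  \<open>A\<close>; this agreement then spreads along the edges of \<open>A\<close>.\<close>

lemma facet_subset_facet: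
  assumes other: "facet_system W E u1 u2 T \<Phi>'" and neq: "u1 \<noteq> u2" and A: "A \<in> \<Phi>"
  obtains B where "B \<in> \<Phi>'" "A \<subseteq> B"
proof -
  interpret O: facet_system W E u1 u2 T \<Phi>' by (rule other)
  obtain v where v: "v \<in> A" "v \<noteq> u1" "v \<noteq> u2" using facet_not_small[OF A, of u1 u2] by blast
  obtain x where x: "{w. E v w} - A = {x}" using facet_omits[OF A v] by blast
  then obtain B where B: "B \<in> \<Phi>'" "v \<in> B" "{w. E v w} - B = {x}"
    using O.facet_exists[of v x] v facet_subset[OF A] by blast
  \<comment> \<open>Agreement at \<open>y\<close> puts its neighbours in \<open>A\<close> into
    \<open>B\<close>, and membership in \<open>B\<close> allows the next step to be made for
    \<open>B\<close> as well as for \<open>A\<close>.\<close>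
  define Y where "Y = {y \<in> A - {u1, u2}. y \<in> B \<and> {w. E y w} - A = {w. E y w} - B}"
  have "Y = A - {u1, u2}"
  proof (rule connD[OF facet_conn[OF A]])
    show "Y \<noteq> {}" using v x B by (auto simp: Y_def)
    fix y z assume y: "y \<in> Y" and z: "z \<in> A - {u1, u2}" and E: "E y z"
    have yA: "y \<in> A" "y \<noteq> u1" "y \<noteq> u2" "y \<in> B" "{w. E y w} - A = {w. E y w} - B"
      using y by (auto simp: Y_def)
    have zB: "z \<in> B" using yA z E by blast
    obtain s where s: "{w. E y w} - A = {s}" using facet_omits[OF A yA(1-3)] by blast
    then have "E y s" "s \<noteq> z" using z by auto
    \<comment> \<open>This 2-face leaves both \<open>A\<close> and \<open>B\<close> at
      \<open>s\<close>; its other neighbour \<open>s'\<close> of \<open>z\<close> is then omitted by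
      both.\<close>
    then obtain F where F: "F \<in> T" "y \<in> F" "{w \<in> F. E y w} = {z, s}"
      using face_exists[of y z s] yA E E_W by blast
    then have zF: "z \<in> F" "s \<in> F" by auto
    have "card {w \<in> F. E z w} = 2" using face_degree[OF F(1) zF(1)] z by auto
    then obtain p q where pq: "{w \<in> F. E z w} = {p, q}" "p \<noteq> q" by (meson card_2_iff)
    have "y \<in> {w \<in> F. E z w}" using F(2) E_sym[OF E] by simp
    then have "y = p \<or> y = q" using pq(1) by simp
    then obtain s' where s': "{w \<in> F. E z w} = {y, s'}" "s' \<noteq> y"
    proof
      assume "y = p"
      then show ?thesis using that[of q] pq by simp
    next
      assume "y = q"
      then show ?thesis using that[of p] pq by (simp add: insert_commute)
    qed
    have "{w. E z w} - A = {s'}"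
      using omitted_nbr_step[OF A yA(1) _ E s _ _ F(1,2) zF s'] z by blast
    moreover have "{w. E z w} - B = {s'}"
      using O.omitted_nbr_step[OF B(1) yA(4) zB E _ _ _ F(1,2) zF s'] s yA(5) z by blast
    ultimately show "z \<in> Y" using z zB by (simp add: Y_def)
  qed (auto simp: Y_def)
  then have "A - {u1, u2} \<subseteq> Y" by blast
  then have sub: "A - {u1, u2} \<subseteq> B" and omit: "\<And>y. y \<in> A - {u1, u2} \<Longrightarrow> {w. E y w} - A = {w. E y w} - B"
    unfolding Y_def by blast+
  \<comment> \<open>An exceptional vertex is recovered from a simple neighbour \<open>z\<close> in
    \<open>A\<close>: it is not omitted by \<open>A\<close> at \<open>z\<close>, hence not by
    \<open>B\<close>.\<close>
  have "u \<in> B" if u: "u \<in> A" "u \<in> {u1, u2}" for u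
  proof -
    obtain u' where u': "{u1, u2} = {u, u'}" "u \<noteq> u'" using u(2) neq by blast
    then obtain z where z: "z \<in> A" "z \<noteq> u'" "E u z" using facet_nbr[OF A u(1)] by blast
    have "z \<noteq> u" using z(3) E_irrefl by blast
    then have "z \<in> A - {u1, u2}" unfolding u'(1) using z by blast
    then show ?thesis using omit[of z] z E_sym u(1) by blast
  qed
  then have "A \<subseteq> B" using sub by blast
  then show ?thesis using that B(1) by blast
qed

lemma facets_eq:
  assumes other: "facet_system W E u1 u2 T \<Phi>'" and neq: "u1 \<noteq> u2"
  shows "\<Phi> \<subseteq> \<Phi>'"
proof
  fix A assume A: "A \<in> \<Phi>"
  obtain B where B: "B \<in> \<Phi>'" "A \<subseteq> B" using facet_subset_facet[OF other neq A] .
  obtain C where C: "C \<in> \<Phi>" "B \<subseteq> C"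
    using facet_system.facet_subset_facet[OF other facet_system_axioms neq B(1)] .
  have "A = C" using facet_antichain[OF A C(1)] B C by blast
  then show "A \<in> \<Phi>'" using B C by simp
qed

end

section \<open>Polytopes with labelled vertices\<close>

lemma aff_dim_vertices:
  assumes "polytope P" shows "aff_dim (vertices P) = aff_dim P"
  using polytope_eq_hull_vertices[OF assms] by (metis aff_dim_convex_hull)

lemma vertices_not_subset_pair:
  assumes "polytope P" "2 \<le> aff_dim P" shows "\<not> vertices P \<subseteq> {a, b}"
proof
  assume "vertices P \<subseteq> {a, b}"
  then have "aff_dim P \<le> aff_dim {a, b}" using aff_dim_subset aff_dim_vertices[OF assms(1)] by metis
  then show False using assms(2) by (simp add: aff_dim_2 split: if_splits)
qed

lemma face_subset_iff_vertices:
  assumes P: "polytope P" and F: "F face_of P" and G: "G face_of P"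
  shows "F \<subseteq> G \<longleftrightarrow> vertices P \<inter> F \<subseteq> G"
proof
  assume sub: "vertices P \<inter> F \<subseteq> G"
  have "F = convex hull (vertices F)"
    using polytope_eq_hull_vertices face_of_polytope_polytope P F by blast
  also have "\<dots> \<subseteq> G" using sub vertices_face[OF F] G by (simp add: hull_minimal face_of_imp_convex)
  finally show "F \<subseteq> G" .
qed blast

lemma faces_eq_of_subset:
  assumes "F face_of P" "G face_of P" "aff_dim F = aff_dim G" "F \<subseteq> G" "convex P"
  shows "F = G"
proof -
  have "F face_of G" using assms face_of_face by blast
  then show ?thesis using face_of_aff_dim_lt[of G F] assms(2,3) face_of_imp_convex by fastforce
qed

text \<open>The intersection is a proper face of a polygon and contains two vertices, so its
  dimension is exactly 1.\<close>

lemma two_face_Int_face: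
  assumes P: "polytope P" and F: "F face_of P" "aff_dim F = 2" and A: "A face_of P" "\<not> F \<subseteq> A"
    and xy: "x \<in> vertices P \<inter> (F \<inter> A)" "y \<in> vertices P \<inter> (F \<inter> A)" "x \<noteq> y"
  shows "edge_rel P x y" "vertices P \<inter> (F \<inter> A) = {x, y}"
proof -
  have FA: "F \<inter> A face_of P" using F A by (simp add: face_of_Int)
  then have "F \<inter> A face_of F" using F(1) face_of_face by blast
  then have lt: "aff_dim (F \<inter> A) < 2"
    using face_of_aff_dim_lt[of F "F \<inter> A"] F face_of_imp_convex A(2) by fastforce
  have "aff_dim {x, y} \<le> aff_dim (F \<inter> A)" using xy by (intro aff_dim_subset) auto
  then have "aff_dim (F \<inter> A) = 1" using lt xy(3) by (simp add: aff_dim_2)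
  then have e: "F \<inter> A edge_of P" using FA by (simp add: edge_of_def)
  obtain a b where ab: "a \<in> vertices P" "b \<in> vertices P" "a \<noteq> b" "F \<inter> A = closed_segment a b"
    using edge_eq_segment[OF P e] .
  have eq: "vertices P \<inter> (F \<inter> A) = {a, b}"
  proof -
    have "vertices P \<inter> (F \<inter> A) = vertices (F \<inter> A)" using vertices_face[OF FA] by simp
    also have "\<dots> = {a, b}" unfolding ab(4) vertices_def extreme_point_of_segment by auto
    finally show ?thesis .
  qed
  then have "{a, b} = {x, y}" using xy by auto
  then show "vertices P \<inter> (F \<inter> A) = {x, y}" "edge_rel P x y"
    using eq e ab(4) by (auto simp: doubleton_eq_iff closed_segment_commute)
qed

text \<open>Faces of the two polytopes live in different spaces; as subsets of a common label set
  they can be compared for equality.\<close>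

locale labelled_polytope =
  fixes P :: "'a::euclidean_space set" and W :: "'v set" and p :: "'v \<Rightarrow> 'a"
    and E :: "'v \<Rightarrow> 'v \<Rightarrow> bool"
  assumes P: "polytope P" and bij: "bij_betw p W (vertices P)"
    and E_iff: "E v w \<longleftrightarrow> v \<in> W \<and> w \<in> W \<and> edge_rel P (p v) (p w)"
begin

definition lab :: "'a set \<Rightarrow> 'v set" where
  "lab F = {v \<in> W. p v \<in> F}"

definition faces :: "int \<Rightarrow> 'v set set" where
  "faces k = lab ` {F. F face_of P \<and> aff_dim F = k}"

lemma p_vertex: "v \<in> W \<Longrightarrow> p v \<in> vertices P"
  using bij by (auto simp: bij_betw_def)

lemma p_in_P: "v \<in> W \<Longrightarrow> p v \<in> P"
  using p_vertex vertices_subset by blast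

lemma vertex_label:
  assumes "x \<in> vertices P" obtains v where "v \<in> W" "x = p v"
  using assms bij that by (auto simp: bij_betw_def)

lemma p_eq_iff: "v \<in> W \<Longrightarrow> w \<in> W \<Longrightarrow> p v = p w \<longleftrightarrow> v = w"
  using bij by (auto simp: bij_betw_def inj_on_def)

lemma p_lab: "p ` lab F = vertices P \<inter> F"
  using bij by (auto simp: bij_betw_def lab_def)

lemma lab_subset: "lab F \<subseteq> W"
  by (auto simp: lab_def)

lemma lab_P: "lab P = W"
  using p_in_P by (auto simp: lab_def)

lemma lab_subset_iff: "F face_of P \<Longrightarrow> G face_of P \<Longrightarrow> lab F \<subseteq> lab G \<longleftrightarrow> F \<subseteq> G"
proof -
  assume FG: "F face_of P" "G face_of P"
  have "lab F \<subseteq> lab G \<longleftrightarrow> vertices P \<inter> F \<subseteq> G"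
  proof
    assume "lab F \<subseteq> lab G"
    then have "p ` lab F \<subseteq> p ` lab G" by blast
    then show "vertices P \<inter> F \<subseteq> G" unfolding p_lab by blast
  next
    assume "vertices P \<inter> F \<subseteq> G"
    then show "lab F \<subseteq> lab G" using p_vertex unfolding lab_def by blast
  qed
  then show ?thesis using face_subset_iff_vertices[OF P FG] by (rule trans[OF _ sym])
qed

lemma finite_W: "finite W"
  using bij finite_vertices[OF P] bij_betw_finite by blast

lemma E_sym: "E x y \<Longrightarrow> E y x"
  by (auto simp: E_iff closed_segment_commute)

lemma E_irrefl: "\<not> E x x"
  by (auto simp: E_iff edge_of_def)

lemma E_iff_nbr: "v \<in> W \<Longrightarrow> E v w \<longleftrightarrow> w \<in> W \<and> p w \<in> nbr P (p v)"
  using p_vertex by (auto simp: E_iff nbr_def)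

lemma p_nbrs: "v \<in> W \<Longrightarrow> p ` {w. E v w} = nbr P (p v)"
proof -
  assume v: "v \<in> W"
  have "x \<in> p ` {w. E v w}" if x: "x \<in> nbr P (p v)" for x
  proof -
    have "x \<in> vertices P" using x by (simp add: nbr_def)
    then obtain w where "w \<in> W" "x = p w" by (rule vertex_label)
    then show ?thesis using x E_iff_nbr[OF v] by blast
  qed
  then show ?thesis using E_iff_nbr[OF v] by blast
qed

lemma inj_on_p: "X \<subseteq> W \<Longrightarrow> inj_on p X"
  using bij by (auto simp: bij_betw_def inj_on_def)

lemma nbrs_subset: "{w. E v w} \<subseteq> W"
  by (auto simp: E_iff)

lemma p_nbrs_lab: "v \<in> W \<Longrightarrow> p ` {w \<in> lab F. E v w} = nbr P (p v) \<inter> F"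
proof -
  assume v: "v \<in> W"
  have "{w \<in> lab F. E v w} = {w. E v w} \<inter> {w. p w \<in> F}" using nbrs_subset by (auto simp: lab_def)
  then have "p ` {w \<in> lab F. E v w} = p ` {w. E v w} \<inter> F" by blast
  then show ?thesis using p_nbrs[OF v] by simp
qed

lemma card_nbrs_lab: "v \<in> W \<Longrightarrow> card {w \<in> lab F. E v w} = card (nbr P (p v) \<inter> F)"
proof -
  assume v: "v \<in> W"
  have "{w \<in> lab F. E v w} \<subseteq> W" using lab_subset by blast
  then have "card (p ` {w \<in> lab F. E v w}) = card {w \<in> lab F. E v w}"
    by (intro card_image inj_on_p)
  then show ?thesis unfolding p_nbrs_lab[OF v] by (rule sym)
qed

lemma card_nbrs: "v \<in> W \<Longrightarrow> card {w. E v w} = card (nbr P (p v))"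
  using p_nbrs[of v] card_image[OF inj_on_p[OF nbrs_subset[of v]]] by simp

text \<open>\<open>S\<close> is cut down to \<open>W\<close> because \<open>p\<close> could send a
  non-label to some vertex that is not to be deleted.\<close>

lemma conn_lab:
  assumes F: "F face_of P" and c: "conn (edge_rel F) (vertices F - p ` (S \<inter> W))"
  shows "conn E (lab F - S)"
  unfolding conn_def
proof (intro allI impI)
  have VF: "vertices F = vertices P \<inter> F" by (rule vertices_face[OF F])
  have edges: "edge_rel F x y \<longleftrightarrow> edge_rel P x y" if "x \<in> F" "y \<in> F" for x y
    using edge_of_face[OF F] closed_segment_subset[OF that face_of_imp_convex[OF F]] by blast
  have mem: "p v \<in> vertices F - p ` (S \<inter> W) \<longleftrightarrow> v \<in> lab F - S" if "v \<in> W" for v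
    using that p_vertex[OF that] p_eq_iff[OF that] by (auto simp: VF lab_def)
  fix Y assume Y: "Y \<subseteq> lab F - S" "Y \<noteq> {}" "\<forall>y\<in>Y. \<forall>x\<in>lab F - S. E y x \<longrightarrow> x \<in> Y"
  have YW: "Y \<subseteq> W" using Y(1) lab_subset by blast
  have "p ` Y = vertices F - p ` (S \<inter> W)"
  proof (rule connD[OF c])
    show "p ` Y \<subseteq> vertices F - p ` (S \<inter> W)"
    proof (rule image_subsetI)
      fix v assume "v \<in> Y"
      then have "v \<in> W" "v \<in> lab F - S" using Y(1) YW by auto
      then show "p v \<in> vertices F - p ` (S \<inter> W)" using mem[of v] by simp
    qed
    show "p ` Y \<noteq> {}" using Y(2) by blast
    fix y x assume y: "y \<in> p ` Y" and x: "x \<in> vertices F - p ` (S \<inter> W)" and e: "edge_rel F y x"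
    obtain v where v: "v \<in> Y" "y = p v" using y by blast
    have "x \<in> vertices P" using x VF by blast
    then obtain w where w: "w \<in> W" "x = p w" by (rule vertex_label)
    have "w \<in> lab F - S" using mem[OF w(1)] x w(2) by simp
    moreover have "E v w"
      using e v w YW Y(1) x edges[of y x] by (auto simp: E_iff VF lab_def)
    ultimately show "x \<in> p ` Y" using Y(3) v(1) w(2) by blast
  qed
  then have img: "p v \<in> p ` Y \<longleftrightarrow> v \<in> lab F - S" if "v \<in> W" for v using mem[OF that] by simp
  have "v \<in> Y" if v: "v \<in> lab F - S" for v
  proof -
    have vW: "v \<in> W" using v lab_subset by blast
    obtain y where y: "y \<in> Y" "p v = p y" using img[OF vW] v by blast
    then have "y \<in> W" using YW by blast
    then show ?thesis using p_eq_iff[OF vW, of y] y by simp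
  qed
  then show "Y = lab F - S" using Y(1) by blast
qed

lemma conn_lab_minus1:
  assumes F: "F face_of P" shows "conn E (lab F - {x})"
proof (rule conn_lab[OF F])
  have pF: "polytope F" using face_of_polytope_polytope P F by blast
  show "conn (edge_rel F) (vertices F - p ` ({x} \<inter> W))"
  proof (cases "x \<in> W \<and> p x \<in> vertices F")
    case True
    then have "{p x} face_of F" by (simp add: vertices_def face_of_singleton)
    then show ?thesis using True conn_minus_face[OF pF] by simp
  next
    case False
    then have "vertices F - p ` ({x} \<inter> W) = vertices F - {}" by auto
    then show ?thesis using conn_minus_face[OF pF empty_face_of] by simp
  qed
qed

text \<open>The two ends are the vertices of a face, whose deletion keeps even a polygon
  connected.\<close>

lemma conn_lab_minus_edge:
  assumes F: "F face_of P" and xy: "x \<in> lab F" "y \<in> lab F" "E x y"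
  shows "conn E (lab F - {x, y})"
proof (rule conn_lab[OF F])
  have pF: "polytope F" using face_of_polytope_polytope P F by blast
  let ?e = "closed_segment (p x) (p y)"
  have "?e \<subseteq> F" using xy closed_segment_subset[OF _ _ face_of_imp_convex[OF F]] by (auto simp: lab_def)
  then have e: "?e face_of F" using xy(3) F by (auto simp: E_iff edge_of_def face_of_face)
  have "vertices F \<inter> ?e = vertices ?e" using vertices_face[OF e] by simp
  also have "\<dots> = {p x, p y}" unfolding vertices_def extreme_point_of_segment by auto
  finally have "vertices F - p ` ({x, y} \<inter> W) = vertices F - ?e"
    using xy by (auto simp: lab_def)
  then show "conn (edge_rel F) (vertices F - p ` ({x, y} \<inter> W))"
    using conn_minus_face[OF pF e] by simp
qed

lemma conn_lab_minus2:
  assumes F: "F face_of P" and d: "3 \<le> aff_dim F"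
  shows "conn E (lab F - {x, y})"
proof (cases "x \<in> W \<and> y \<in> W")
  case True
  have "polytope F" using face_of_polytope_polytope P F by blast
  then show ?thesis using conn_lab[OF F, of "{x, y}"] conn_minus_two[OF _ d] True by simp
next
  case False
  then have "lab F - {x, y} = lab F - {x} \<or> lab F - {x, y} = lab F - {y}"
    using lab_subset[of F] by blast
  then show ?thesis using conn_lab_minus1[OF F] by metis
qed

lemma lab_not_small:
  assumes F: "F face_of P" and d: "2 \<le> aff_dim F"
  shows "\<not> lab F \<subseteq> {x, y}"
proof
  assume "lab F \<subseteq> {x, y}"
  then have "p ` lab F \<subseteq> {p x, p y}" by blast
  then have "vertices F \<subseteq> {p x, p y}" using p_lab vertices_face[OF F] by simp
  then show False using vertices_not_subset_pair[OF face_of_polytope_polytope[OF P F] d] by blast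
qed

text \<open>A linear-fractional function remains one on each face, so improving edges can be found
  inside the face.\<close>

lemma lin_frac_good:
  assumes g: "lin_frac P g" and F: "F face_of P" and v: "v \<in> lab F"
    and loc: "\<forall>w\<in>lab F. E v w \<longrightarrow> g (p w) < g (p v)" and w: "w \<in> lab F"
  shows "g (p w) \<le> g (p v)"
proof (rule ccontr)
  assume "\<not> ?thesis"
  then have less: "g (p v) < g (p w)" by simp
  have pF: "polytope F" using face_of_polytope_polytope P F by blast
  have gF: "lin_frac F g" using lin_frac_subset[OF g face_of_imp_subset[OF F]] .
  have vF: "p v \<in> vertices F" "p w \<in> F"
    using v w p_vertex vertices_face[OF F] by (auto simp: lab_def)
  obtain x where x: "x \<in> vertices F" "edge_rel F (p v) x" "g (p v) < g x"
    using lin_frac_improving[OF pF gF vF less] .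
  then have x': "x \<in> vertices P" "x \<in> F" using vertices_face[OF F] by auto
  obtain y where y: "y \<in> W" "x = p y" using vertex_label[OF x'(1)] .
  then have "y \<in> lab F" "E v y"
    using x x' v edge_of_face[OF F] by (auto simp: lab_def E_iff)
  then show False using loc x(3) y(2) by force
qed

lemma order_exists_lab:
  assumes F: "F face_of P" and x: "x \<in> lab F" and y: "y \<in> W - lab F"
  shows "\<exists>g :: 'v \<Rightarrow> real. inj_on g W
    \<and> (\<forall>F\<in>faces k. \<forall>v\<in>F. (\<forall>w\<in>F. E v w \<longrightarrow> g w < g v) \<longrightarrow> (\<forall>w\<in>F. g w \<le> g v))
    \<and> (\<forall>v\<in>W - {x}. g x < g v) \<and> (\<forall>v\<in>W - {y}. g v < g y)
    \<and> (\<forall>a\<in>lab F. \<forall>b\<in>W - lab F. g a < g b)"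
proof -
  have xW: "x \<in> W" "p x \<in> F" using x by (auto simp: lab_def)
  have yW: "y \<in> W" "p y \<in> vertices P" "p y \<notin> F" using y p_vertex by (auto simp: lab_def)
  have px: "{p x} face_of P" using p_vertex[OF xW(1)] by (simp add: vertices_def face_of_singleton)
  obtain g where g: "lin_frac P g" "inj_on g (vertices P)"
    "\<And>a b. a \<in> vertices P \<inter> {p x} \<Longrightarrow> b \<in> vertices P - {p x} \<Longrightarrow> g a < g b"
    "\<And>a b. a \<in> vertices P \<inter> F \<Longrightarrow> b \<in> vertices P - F \<Longrightarrow> g a < g b"
    "\<And>b. b \<in> vertices P - {p y} \<Longrightarrow> g b < g (p y)"
    using shelling_function_exists[OF P px F _ yW(2,3)] xW(2) by (metis empty_subsetI insert_subset)
  show ?thesis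
  proof (intro exI[of _ "g \<circ> p"] conjI)
    show "inj_on (g \<circ> p) W" using g(2) bij by (auto simp: bij_betw_def intro: comp_inj_on)
    show "\<forall>F\<in>faces k. \<forall>v\<in>F. (\<forall>w\<in>F. E v w \<longrightarrow> (g \<circ> p) w < (g \<circ> p) v) \<longrightarrow> (\<forall>w\<in>F. (g \<circ> p) w \<le> (g \<circ> p) v)"
    proof (intro ballI impI)
      fix L v w assume L: "L \<in> faces k" and v: "v \<in> L" "w \<in> L"
        and loc: "\<forall>w\<in>L. E v w \<longrightarrow> (g \<circ> p) w < (g \<circ> p) v"
      obtain G where G: "G face_of P" "L = lab G" using L by (auto simp: faces_def)
      show "(g \<circ> p) w \<le> (g \<circ> p) v"
        using lin_frac_good[OF g(1) G(1), of v w] v loc G(2) by simp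
    qed
    show "\<forall>v\<in>W - {x}. (g \<circ> p) x < (g \<circ> p) v"
      using g(3) p_vertex p_eq_iff xW by auto
    show "\<forall>v\<in>W - {y}. (g \<circ> p) v < (g \<circ> p) y"
      using g(5) p_vertex p_eq_iff yW by auto
    show "\<forall>a\<in>lab F. \<forall>b\<in>W - lab F. (g \<circ> p) a < (g \<circ> p) b"
      using g(4) p_vertex by (auto simp: lab_def)
  qed
qed

lemma lab_Int_two_face:
  assumes F: "F face_of P" "aff_dim F = 2" and A: "A face_of P" "\<not> F \<subseteq> A"
    and xy: "x \<in> lab F \<inter> lab A" "y \<in> lab F \<inter> lab A" "x \<noteq> y"
  shows "lab F \<inter> lab A = {x, y} \<and> E x y"
proof -
  have W: "x \<in> W" "y \<in> W" using xy by (auto simp: lab_def)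
  have pxy: "p x \<in> vertices P \<inter> (F \<inter> A)" "p y \<in> vertices P \<inter> (F \<inter> A)" "p x \<noteq> p y"
    using xy W p_vertex p_eq_iff by (auto simp: lab_def)
  note two = two_face_Int_face[OF P F A pxy]
  have "z \<in> {x, y}" if z: "z \<in> lab F \<inter> lab A" for z
  proof -
    have zW: "z \<in> W" "p z \<in> vertices P \<inter> (F \<inter> A)" using z p_vertex by (auto simp: lab_def)
    then have "p z = p x \<or> p z = p y" using two(2) by blast
    then show ?thesis using zW(1) W p_eq_iff by blast
  qed
  then have "lab F \<inter> lab A = {x, y}" using xy by blast
  then show ?thesis using two(1) W by (simp add: E_iff)
qed

end

section \<open>Polytopes with two exceptional vertices\<close>

text \<open>Simplicity enters as independence of the edge directions, the form from which neighbours
  are seen to span faces.\<close>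

locale nearly_simple_polytope = labelled_polytope +
  fixes u1 u2 :: 'b
  assumes u_W: "u1 \<in> W" "u2 \<in> W"
    and simple: "v \<in> W \<Longrightarrow> v \<noteq> u1 \<Longrightarrow> v \<noteq> u2 \<Longrightarrow> independent ((\<lambda>w. w - p v) ` nbr P (p v))"
begin

lemma face_exists_lab:
  assumes v: "v \<in> W" "v \<noteq> u1" "v \<noteq> u2" and B: "B \<subseteq> {w. E v w}"
  obtains F where "F face_of P" "v \<in> lab F" "{w \<in> lab F. E v w} = B" "aff_dim F = int (card B)"
proof -
  have "p ` B \<subseteq> nbr P (p v)" using p_nbrs[OF v(1)] B by blast
  then obtain F where F: "F face_of P" "p v \<in> F" "nbr P (p v) \<inter> F = p ` B"
    using simple_face_exists[OF P p_vertex[OF v(1)] simple[OF v]] by metis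
  have BW: "B \<subseteq> W" using B nbrs_subset by blast
  have "p ` {w \<in> lab F. E v w} = p ` B" using p_nbrs_lab[OF v(1)] F(3) by simp
  then have "{w \<in> lab F. E v w} = B"
    using inj_on_image_eq_iff[OF inj_on_p[OF order_refl], of "{w \<in> lab F. E v w}" B] BW lab_subset by blast
  moreover have "aff_dim F = int (card B)"
    using aff_dim_face_simple[OF P p_vertex[OF v(1)] simple[OF v] F(1,2)] F(3)
      card_image[OF inj_on_p[OF BW]] by simp
  ultimately show ?thesis using that F v(1) by (simp add: lab_def)
qed

lemma face_degree_lab:
  assumes "F face_of P" "v \<in> lab F" "v \<noteq> u1" "v \<noteq> u2"
  shows "int (card {w \<in> lab F. E v w}) = aff_dim F"
proof -
  have v: "v \<in> W" "p v \<in> F" using assms(2) by (auto simp: lab_def)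
  then show ?thesis
    using aff_dim_face_simple[OF P p_vertex[OF v(1)] simple[OF v(1) assms(3,4)] assms(1) v(2)]
      card_nbrs_lab[OF v(1)] by simp
qed

lemma two_face_system: "two_face_system W E u1 u2 (faces 2)"
proof (unfold_locales, goal_cases)
  case 1 show ?case by (rule finite_W)
next
  case (2 x y) then show ?case by (rule E_sym)
next
  case 3 show ?case by (rule E_irrefl)
next
  case (4 x y) then show ?case by (simp add: E_iff)
next
  case 5 show ?case by (rule u_W)
next
  case 6 show ?case by (rule u_W)
next
  case 7 then show ?case using lab_subset by (auto simp: faces_def)
next
  case (8 v a b)
  then obtain F where "F face_of P" "v \<in> lab F" "{w \<in> lab F. E v w} = {a, b}" "aff_dim F = int (card {a, b})"
    using face_exists_lab[of v "{a, b}"] by blast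
  then show ?case using 8(6) by (auto simp: faces_def)
next
  case (9 F v)
  then show ?case using face_degree_lab by (fastforce simp: faces_def)
next
  case (10 F G x y)
  then obtain F' G' where FG: "F' face_of P" "aff_dim F' = 2" "F = lab F'" "G' face_of P" "aff_dim G' = 2" "G = lab G'"
    by (auto simp: faces_def)
  then have "\<not> F' \<subseteq> G'" using 10(3) faces_eq_of_subset[of F' P G'] polytope_imp_convex[OF P] by auto
  then show ?case using lab_Int_two_face[OF FG(1,2,4)] 10 FG by blast
next
  case (11 F x) then show ?case using conn_lab_minus1 by (auto simp: faces_def)
next
  case (12 F x y) then show ?case using conn_lab_minus_edge by (auto simp: faces_def)
next
  case (13 F x y) then show ?case using lab_not_small by (fastforce simp: faces_def)
next
  case (14 x y)
  \<comment> \<open>An order without a prescribed initial 2-face comes from the initial face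
    \<open>{p x}\<close>.\<close>
  have "{p x} face_of P" using p_vertex[OF 14(1)] by (simp add: vertices_def face_of_singleton)
  moreover have "lab {p x} = {x}" using 14(1) p_eq_iff by (auto simp: lab_def)
  ultimately show ?case using order_exists_lab[of "{p x}" x y 2] 14 by auto
next
  case (15 F x y)
  then obtain F' where F: "F' face_of P" "F = lab F'" by (auto simp: faces_def)
  show ?case using order_exists_lab[OF F(1), of x y 2] 15 F(2) by simp
qed

text \<open>\<open>4 \<le> d\<close> makes the facets at least 3-dimensional, so they stay connected
  after the deletion of any two vertices.\<close>

lemma facet_system:
  assumes d: "aff_dim P = int d" "4 \<le> d"
  shows "facet_system W E u1 u2 (faces 2) (faces (int d - 1))"
proof (rule facet_system.intro[OF two_face_system], unfold_locales, goal_cases)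
  case 1 then show ?case using lab_subset by (auto simp: faces_def)
next
  case (2 v x)
  have fin: "finite {w. E v w}" using nbrs_subset finite_W finite_subset by blast
  have "card {w. E v w} = d"
    using card_nbrs[OF 2(1)] aff_dim_eq_card_nbr[OF P p_vertex[OF 2(1)] simple[OF 2(1-3)]] d(1) by simp
  then have "card ({w. E v w} - {x}) = d - 1" using 2(4) fin by (simp add: card_Diff_singleton)
  moreover obtain F where F: "F face_of P" "v \<in> lab F" "{w \<in> lab F. E v w} = {w. E v w} - {x}"
      "aff_dim F = int (card ({w. E v w} - {x}))"
    using face_exists_lab[OF 2(1-3), of "{w. E v w} - {x}"] by blast
  ultimately have "lab F \<in> faces (int d - 1)" using d(2) by (auto simp: faces_def of_nat_diff)
  moreover have "{w. E v w} - lab F = {x}" using F(3) 2(4) by blast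
  ultimately show ?case using F(2) by blast
next
  case (3 A v)
  then obtain F where F: "F face_of P" "aff_dim F = int d - 1" "A = lab F" by (auto simp: faces_def)
  have v: "v \<in> W" using 3(2) F(3) by (simp add: lab_def)
  have fin: "finite {w. E v w}" using nbrs_subset finite_W finite_subset by blast
  have "card {w. E v w} = d"
    using card_nbrs[OF v] aff_dim_eq_card_nbr[OF P p_vertex[OF v] simple[OF v 3(3,4)]] d(1) by simp
  moreover have "int (card {w \<in> lab F. E v w}) = int d - 1"
    using face_degree_lab[OF F(1)] 3 F by simp
  moreover have "{w. E v w} - A = {w. E v w} - {w \<in> lab F. E v w}" using F(3) by blast
  moreover have "card ({w. E v w} - {w \<in> lab F. E v w}) = card {w. E v w} - card {w \<in> lab F. E v w}"
    using fin by (intro card_Diff_subset) (auto intro: finite_subset)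
  ultimately have "card ({w. E v w} - A) = 1" using d(2) by simp
  then show ?case by (meson card_1_singletonE)
next
  case (4 A F x y)
  then obtain F' A' where FA: "F' face_of P" "aff_dim F' = 2" "F = lab F'" "A' face_of P" "A = lab A'"
    by (auto simp: faces_def)
  then have "\<not> F' \<subseteq> A'" using 4(3) lab_subset_iff by blast
  then show ?case using lab_Int_two_face[OF FA(1,2,4)] 4 FA by blast
next
  case (5 A x y) then show ?case using conn_lab_minus2 d(2) by (auto simp: faces_def)
next
  case (6 A x y) then show ?case using lab_not_small d(2) by (auto simp: faces_def)
next
  case (7 A B)
  then obtain F G where FG: "F face_of P" "aff_dim F = int d - 1" "A = lab F"
      "G face_of P" "aff_dim G = int d - 1" "B = lab G"
    by (auto simp: faces_def)
  then have "F \<subseteq> G" using 7(3) lab_subset_iff by simp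
  then show ?case using faces_eq_of_subset[OF FG(1,4)] FG polytope_imp_convex[OF P] by simp
qed

end

section \<open>The face lattice from the facets\<close>

context labelled_polytope
begin

text \<open>A nonempty proper face is the intersection of the facets above it. The empty family
  yields \<open>P\<close>, whence the intersection with \<open>W\<close>; the empty face is adjoined
  separately.\<close>

lemma lab_faces_eq:
  assumes d: "aff_dim P = int d" "1 \<le> d"
  shows "lab ` {F. F face_of P} = insert {} {W \<inter> \<Inter>\<A> | \<A>. \<A> \<subseteq> faces (int d - 1)}" (is "_ = ?R")
proof
  have facet: "F facet_of P \<longleftrightarrow> F face_of P \<and> aff_dim F = int d - 1" for F
    using d by (auto simp: facet_of_def)
  show "lab ` {F. F face_of P} \<subseteq> ?R"
  proof (rule image_subsetI)
    fix F assume "F \<in> {F. F face_of P}"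
    then have F: "F face_of P" by simp
    show "lab F \<in> ?R"
    proof (cases "lab F = {}")
      case ne: False
      have "lab F = W \<inter> \<Inter>(lab ` {G. G facet_of P \<and> F \<subseteq> G})"
      proof (cases "F = P")
        case True
        have none: "{G. G facet_of P \<and> P \<subseteq> G} = {}"
          using facet facet_of_imp_subset by (force simp: d)
        show ?thesis unfolding True lab_P none by simp
      next
        case False
        have "F \<noteq> {}" using ne by (auto simp: lab_def)
        then have "F = \<Inter>{G. G facet_of P \<and> F \<subseteq> G}"
          using face_of_polyhedron[OF polytope_imp_polyhedron[OF P] F] False by blast
        then have "p v \<in> F \<longleftrightarrow> (\<forall>G\<in>{G. G facet_of P \<and> F \<subseteq> G}. p v \<in> G)" for v by blast
        then show ?thesis by (auto simp: lab_def)
      qed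
      moreover have "lab ` {G. G facet_of P \<and> F \<subseteq> G} \<subseteq> faces (int d - 1)"
        by (auto simp: faces_def facet)
      ultimately show ?thesis by blast
    qed simp
  qed
  show "?R \<subseteq> lab ` {F. F face_of P}"
  proof
    fix L assume "L \<in> ?R"
    then consider "L = {}" | \<A> where "\<A> \<subseteq> faces (int d - 1)" "L = W \<inter> \<Inter>\<A>" by blast
    then show "L \<in> lab ` {F. F face_of P}"
    proof cases
      case 1
      then have "L = lab {}" by (simp add: lab_def)
      then show ?thesis by blast
    next
      case 2
      then obtain \<G> where G: "\<G> \<subseteq> {F. F face_of P \<and> aff_dim F = int d - 1}" "\<A> = lab ` \<G>"
        unfolding faces_def by (meson subset_image_iff)
      have "P \<inter> \<Inter>\<G> face_of P"
      proof (cases "\<G> = {}")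
        case True
        then show ?thesis using face_of_refl[OF polytope_imp_convex[OF P]] by simp
      next
        case False
        then have "\<Inter>\<G> face_of P" using G(1) by (intro face_of_Inter) auto
        then show ?thesis by (simp add: face_of_Int face_of_refl polytope_imp_convex[OF P])
      qed
      moreover have "L = lab (P \<inter> \<Inter>\<G>)"
        unfolding 2(2) G(2) using p_in_P by (auto simp: lab_def)
      ultimately show ?thesis by blast
    qed
  qed
qed

lemma inj_on_lab: "inj_on lab {F. F face_of P}"
proof (rule inj_onI)
  fix F G assume "F \<in> {F. F face_of P}" "G \<in> {F. F face_of P}" and eq: "lab F = lab G"
  then have FG: "F face_of P" "G face_of P" by auto
  show "F = G" using lab_subset_iff[OF FG] lab_subset_iff[OF FG(2,1)] eq by simp
qed

end

lemma card_edges_at_vertex: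
  assumes P: "polytope P" and v: "v \<in> vertices P"
  shows "card {e. e edge_of P \<and> v \<in> e} = card (nbr P v)"
proof -
  have "bij_betw (closed_segment v) (nbr P v) {e. e edge_of P \<and> v \<in> e}"
  proof (rule bij_betw_imageI)
    show "inj_on (closed_segment v) (nbr P v)"
      by (rule inj_onI) (auto simp: closed_segment_eq doubleton_eq_iff)
    show "closed_segment v ` nbr P v = {e. e edge_of P \<and> v \<in> e}"
    proof
      show "closed_segment v ` nbr P v \<subseteq> {e. e edge_of P \<and> v \<in> e}" by (auto simp: nbr_def)
      show "{e. e edge_of P \<and> v \<in> e} \<subseteq> closed_segment v ` nbr P v"
        using edge_at_vertex[OF P _ v] by blast
    qed
  qed
  then show ?thesis using bij_betw_same_card by fastforce
qed

lemma polytope_graph_edge_iff: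
  "u \<in> vertices P \<Longrightarrow> v \<in> vertices P \<Longrightarrow> {u, v} \<in> snd (polytope_graph P) \<longleftrightarrow> edge_rel P u v"
  by (auto simp: polytope_graph_def doubleton_eq_iff closed_segment_commute)

lemma nearly_simple_facets_eq:
  assumes A: "nearly_simple_polytope P W p E u1 u2" and B: "nearly_simple_polytope Q W q E u1 u2"
    and d: "aff_dim P = int d" "aff_dim Q = int d" "3 \<le> d" and neq: "u1 \<noteq> u2"
  shows "labelled_polytope.faces P W p (int d - 1) = labelled_polytope.faces Q W q (int d - 1)"
proof -
  interpret A: nearly_simple_polytope P W p E u1 u2 by (rule A)
  interpret B: nearly_simple_polytope Q W q E u1 u2 by (rule B)
  have "two_systems W E u1 u2 (A.faces 2) (B.faces 2)"
    using A.two_face_system B.two_face_system neq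
    by (simp add: two_systems_def two_systems_axioms_def)
  then have eq: "A.faces 2 = B.faces 2" by (rule two_systems.systems_eq)
  show ?thesis
  \<comment> \<open>In dimension 3 the facets are the 2-faces themselves.\<close>
  proof (cases "d = 3")
    case True
    then show ?thesis using eq by simp
  next
    case False
    then have "4 \<le> d" using d(3) by simp
    then have "facet_system W E u1 u2 (A.faces 2) (A.faces (int d - 1))"
        "facet_system W E u1 u2 (A.faces 2) (B.faces (int d - 1))"
      using A.facet_system[OF d(1)] B.facet_system[OF d(2)] eq by simp_all
    then show ?thesis using facet_system.facets_eq neq by (metis subset_antisym)
  qed
qed

text \<open>Equal facet labels give the same label sets for all faces, so the label set of a face of
  \<open>Q\<close> can be read back as a face of \<open>P\<close>.\<close>

lemma combinatorially_isomorphic_if_facets_eq: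
  assumes A: "labelled_polytope P W p E" and B: "labelled_polytope Q W q E"
    and d: "aff_dim P = int d" "aff_dim Q = int d" "1 \<le> d"
    and eq: "labelled_polytope.faces P W p (int d - 1) = labelled_polytope.faces Q W q (int d - 1)"
  shows "combinatorially_isomorphic Q P"
proof -
  interpret A: labelled_polytope P W p E by (rule A)
  interpret B: labelled_polytope Q W q E by (rule B)
  have img: "A.lab ` face_lattice P = B.lab ` face_lattice Q"
    using A.lab_faces_eq[OF d(1,3)] B.lab_faces_eq[OF d(2,3)] eq by (simp add: face_lattice_def)
  have bijs: "bij_betw A.lab (face_lattice P) (A.lab ` face_lattice P)"
      "bij_betw B.lab (face_lattice Q) (A.lab ` face_lattice P)"
    using inj_on_imp_bij_betw[OF A.inj_on_lab] inj_on_imp_bij_betw[OF B.inj_on_lab] img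
    by (simp_all add: face_lattice_def)
  define \<phi> where "\<phi> = inv_into (face_lattice P) A.lab \<circ> B.lab"
  have bij: "bij_betw \<phi> (face_lattice Q) (face_lattice P)"
    unfolding \<phi>_def using bij_betw_trans[OF bijs(2) bij_betw_inv_into[OF bijs(1)]] .
  have lab: "A.lab (\<phi> F) = B.lab F" "\<phi> F face_of P" if F: "F \<in> face_lattice Q" for F
  proof -
    have "B.lab F \<in> A.lab ` face_lattice P" using F img by blast
    then show "A.lab (\<phi> F) = B.lab F" by (simp add: \<phi>_def f_inv_into_f)
    show "\<phi> F face_of P" using bij F by (auto simp: bij_betw_def face_lattice_def)
  qed
  have "F \<subseteq> G \<longleftrightarrow> \<phi> F \<subseteq> \<phi> G" if FG: "F \<in> face_lattice Q" "G \<in> face_lattice Q" for F G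
  proof -
    have "F \<subseteq> G \<longleftrightarrow> B.lab F \<subseteq> B.lab G"
      using B.lab_subset_iff FG by (simp add: face_lattice_def)
    also have "\<dots> \<longleftrightarrow> \<phi> F \<subseteq> \<phi> G"
      using A.lab_subset_iff[OF lab(2)[OF FG(1)] lab(2)[OF FG(2)]] lab(1) FG by simp
    finally show ?thesis .
  qed
  then show ?thesis unfolding combinatorially_isomorphic_def using bij by blast
qed

theorem theorem4p8:
  fixes P :: "'a::euclidean_space set" and d :: nat
  assumes "d_polytope d P"
    and "card (nonsimple_vertices d P) = 2"
  shows "\<forall>Q :: 'b::euclidean_space set.
           d_polytope d Q \<and> graph_isomorphic (polytope_graph Q) (polytope_graph P)
             \<longrightarrow> combinatorially_isomorphic Q P"
proof (intro allI impI)
  fix Q :: "'b set"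
  assume Q: "d_polytope d Q \<and> graph_isomorphic (polytope_graph Q) (polytope_graph P)"
  have P: "polytope P" "aff_dim P = int d" and pQ: "polytope Q" "aff_dim Q = int d"
    using assms(1) Q by (auto simp: d_polytope_def)
  have nonsimple: "nonsimple_vertices d P = {v \<in> vertices P. card (nbr P v) > d}"
    unfolding nonsimple_vertices_def using card_edges_at_vertex[OF P(1)] by auto
  obtain u1 u2 where u: "nonsimple_vertices d P = {u1, u2}" "u1 \<noteq> u2"
    using assms(2) by (meson card_2_iff)
  then have u1: "u1 \<in> vertices P" "card (nbr P u1) > d" and u2: "u2 \<in> vertices P"
    using nonsimple by auto
  \<comment> \<open>In dimension at most 2 no degree exceeds the dimension, so \<open>u1\<close>
    could not be nonsimple.\<close>
  have d: "3 \<le> d"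
    using card_nbr_le_small_dim[OF P(1) u1(1)] u1(2) P(2) by (cases "d \<le> 2") auto
  obtain f where f: "bij_betw f (vertices Q) (vertices P)"
      "\<And>u v. u \<in> vertices Q \<Longrightarrow> v \<in> vertices Q \<Longrightarrow>
        {u, v} \<in> snd (polytope_graph Q) \<longleftrightarrow> {f u, f v} \<in> snd (polytope_graph P)"
    using Q unfolding graph_isomorphic_def by (auto simp: polytope_graph_def)
  \<comment> \<open>\<open>P\<close> is labelled by its own vertices, and \<open>Q\<close> by the
    same labels through the inverse of the graph isomorphism.\<close>
  define W where "W = vertices P"
  define q where "q = inv_into (vertices Q) f"
  define E where "E v w \<longleftrightarrow> v \<in> W \<and> w \<in> W \<and> edge_rel P v w" for v w
  have q: "bij_betw q W (vertices Q)"
    unfolding q_def W_def by (rule bij_betw_inv_into[OF f(1)])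
  have qv: "q v \<in> vertices Q" "f (q v) = v" if "v \<in> W" for v
    using q that f(1) by (auto simp: bij_betw_def q_def W_def f_inv_into_f)
  have edge_q: "edge_rel P v w \<longleftrightarrow> edge_rel Q (q v) (q w)" if vw: "v \<in> W" "w \<in> W" for v w
    using f(2)[OF qv(1)[OF vw(1)] qv(1)[OF vw(2)]] vw
    by (simp add: qv polytope_graph_edge_iff W_def)
  interpret A: labelled_polytope P W id E
    by unfold_locales (simp_all add: P E_def W_def)
  interpret B: labelled_polytope Q W q E
    by unfold_locales (use pQ q edge_q in \<open>auto simp: E_def\<close>)
  have degree: "card (nbr P v) = d" if v: "v \<in> W" "v \<noteq> u1" "v \<noteq> u2" for v
  proof -
    have "\<not> card (nbr P v) > d" using v u(1) nonsimple by (auto simp: W_def)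
    then show ?thesis using aff_dim_le_card_nbr[OF P(1), of v] v P(2) by (simp add: W_def)
  qed
  interpret A: nearly_simple_polytope P W id E u1 u2
  proof
    show "u1 \<in> W" "u2 \<in> W" using u1(1) u2 by (simp_all add: W_def)
    show "independent ((\<lambda>w. w - id v) ` nbr P (id v))" if v: "v \<in> W" "v \<noteq> u1" "v \<noteq> u2" for v
      using independent_nbrs[OF P(1), of v] degree[OF v] v(1) P(2) by (simp add: W_def)
  qed
  interpret B: nearly_simple_polytope Q W q E u1 u2
  proof
    show "u1 \<in> W" "u2 \<in> W" using u1(1) u2 by (simp_all add: W_def)
    show "independent ((\<lambda>w. w - q v) ` nbr Q (q v))" if v: "v \<in> W" "v \<noteq> u1" "v \<noteq> u2" for v
    proof (rule independent_nbrs[OF pQ(1) qv(1)[OF v(1)]])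
      \<comment> \<open>Only the degree is carried from \<open>P\<close> to \<open>Q\<close>; since
        the dimensions agree, it makes the vertex of \<open>Q\<close> simple as well.\<close>
      show "aff_dim Q = int (card (nbr Q (q v)))"
        using A.card_nbrs[OF v(1)] B.card_nbrs[OF v(1)] degree[OF v] pQ(2) by simp
    qed
  qed
  have "A.faces (int d - 1) = B.faces (int d - 1)"
    using nearly_simple_facets_eq[OF A.nearly_simple_polytope_axioms B.nearly_simple_polytope_axioms
        P(2) pQ(2) d u(2)] .
  then show "combinatorially_isomorphic Q P"
    using combinatorially_isomorphic_if_facets_eq[OF A.labelled_polytope_axioms
        B.labelled_polytope_axioms P(2) pQ(2)] d by simp
qed

end
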